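(* Let $a$ be a positive integer and $b$ an integer with $b>-a$, $b$ even, and $\gcd(a,b)=1$. Then, for any integer $n\not\equiv 0\pmod 4$ greater than $$4a(7a(a-1)+1)+2(7a-2)b+2(2a(2a-1)+b)\sqrt{6(2a(a-1)+b)},$$ there are $w,x,y,z\in\mathbb{N}$ such that $$n=w(aw+b)+x(ax+b)+y(ay+b)+z(az+b).$$
   Context: $\mathbb{N}=\{0,1,2,\ldots\}$. *)

theory Defs
  imports Complex_Main "HOL-Number_Theory.Cong"
begin

end

theory Submission
  imports "HOL-Analysis.Analysis" "HOL-Number_Theory.Number_Theory"
    "HOL-Computational_Algebra.Squarefree" Defs
begin

text \<open>
  Write \<open>n = a A + b B\<close> with \<open>A = w\<^sup>2 + x\<^sup>2 + y\<^sup>2 + z\<^sup>2\<close> and \<open>B = w + x + y + z\<close>. By Cauchy's lemma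
  such \<open>w, x, y, z\<close> exist once \<open>B \<ge> 0\<close>, \<open>B\<^sup>2 \<le> 4 A\<close>, \<open>3 A < B\<^sup>2 + 2 B + 4\<close> and the parities fit;
  the bound on \<open>n\<close> makes the admissible \<open>B\<close> fill an interval of length at least \<open>2 a\<close>, which
  contains a representative of the residue class modulo \<open>2 a\<close> that \<open>B\<close> has to lie in.

  Cauchy's lemma rests on the three-square theorem for \<open>n \<equiv> 1, 2 (mod 4)\<close> and \<open>n \<equiv> 3 (mod 8)\<close>.
  For squarefree \<open>n\<close> one chooses a prime \<open>q \<equiv> 1 (mod 4)\<close> such that, with \<open>m = q\<close> or \<open>m = 2 q\<close>,
  \<open>n\<close> is a square modulo \<open>m\<close> and \<open>- m\<close> is a square modulo \<open>n\<close>; then \<open>n x\<^sup>2 = z\<^sup>2 + m y\<^sup>2\<close> is solvable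
  by the pigeonhole principle, \<open>m\<close> is a sum of two rational squares, and the Davenport--Cassels
  descent turns the rational representation of \<open>n\<close> into an integral one. The choice of \<open>q\<close>
  prescribes only quadratic characters, so Dirichlet's argument is needed for real characters only.
\<close>

subsection \<open>Real characters and their L-series\<close>

text \<open>Abel summation: comparing the weighted sum with \<open>?B n * g n\<close> makes each
  induction step contribute only \<open>?B (Suc n) * (g n - g (Suc n))\<close>, and the bounds on
  these telescope.\<close>

lemma abel_bound:
  fixes f g :: "nat \<Rightarrow> real"
  assumes "m \<le> n"
    and D: "\<And>k. m \<le> k \<Longrightarrow> \<bar>\<Sum>i\<in>{m..<k}. f i\<bar> \<le> D"
    and dec: "\<And>i. m \<le> i \<Longrightarrow> g (Suc i) \<le> g i"
    and nonneg: "\<And>i. m \<le> i \<Longrightarrow> 0 \<le> g i"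
  shows "\<bar>\<Sum>i\<in>{m..<n}. f i * g i\<bar> \<le> D * g m"
proof -
  let ?B = "\<lambda>k. \<Sum>i\<in>{m..<k}. f i"
  have "\<bar>(\<Sum>i\<in>{m..<n}. f i * g i) - ?B n * g n\<bar> \<le> D * (g m - g n)"
    using assms(1)
  proof (induction n rule: dec_induct)
    case base
    then show ?case by simp
  next
    case (step n)
    have "(\<Sum>i\<in>{m..<Suc n}. f i * g i) - ?B (Suc n) * g (Suc n)
        = ((\<Sum>i\<in>{m..<n}. f i * g i) - ?B n * g n) + ?B (Suc n) * (g n - g (Suc n))"
      using step.hyps by (simp add: algebra_simps)
    moreover have "\<bar>?B (Suc n) * (g n - g (Suc n))\<bar> \<le> D * (g n - g (Suc n))"
      using D[of "Suc n"] dec[of n] step.hyps by (simp only: abs_mult) (intro mult_mono, auto)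
    ultimately show ?case
      using step.IH by (simp add: algebra_simps)
  qed
  moreover have "\<bar>?B n * g n\<bar> \<le> D * g n"
    using D[of n] nonneg[of n] assms(1) by (simp only: abs_mult) (intro mult_mono, auto)
  ultimately show ?thesis
    by (simp add: algebra_simps)
qed

locale real_char =
  fixes M :: nat and chi :: "nat \<Rightarrow> real"
  assumes modulus_pos: "0 < M"
    and mult: "chi (a * b) = chi a * chi b"
    and periodic: "chi (k mod M) = chi k"
    and coprime_cases: "coprime k M \<Longrightarrow> chi k = 1 \<or> chi k = -1"
    and not_coprime: "\<not> coprime k M \<Longrightarrow> chi k = 0"
begin

lemma chi_cases: "chi k = 1 \<or> chi k = -1 \<or> chi k = 0"
  using coprime_cases not_coprime by blast

lemma abs_le_1: "\<bar>chi k\<bar> \<le> 1"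
  using chi_cases[of k] by auto

lemma chi_Suc_0 [simp]: "chi (Suc 0) = 1"
  using mult[of 1 1] coprime_cases[of 1] by auto

lemma add_modulus: "chi (k + M) = chi k"
  by (metis mod_add_self2 periodic)

lemma power: "chi (a ^ n) = chi a ^ n"
  by (induction n) (simp_all add: mult)

end

locale nonprincipal_real_char = real_char +
  assumes nonprincipal: "\<exists>c. chi c = -1"
begin

text \<open>Multiplication by a unit \<open>c\<close> with \<open>chi c = -1\<close> permutes the
  residues and negates every value, so the sum equals its own negative.\<close>

lemma sum_period: "(\<Sum>k<M. chi k) = 0"
proof -
  obtain c where c: "chi c = -1" using nonprincipal by blast
  then have cop: "coprime c M" using not_coprime[of c] by force
  have "inj_on (\<lambda>k. c * k mod M) {..<M}"
  proof (rule inj_onI)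
    fix x y assume "x \<in> {..<M}" "y \<in> {..<M}" "c * x mod M = c * y mod M"
    then have "[c * x = c * y] (mod M)" by (simp add: cong_def)
    then have "[x = y] (mod M)" using cop by (metis cong_mult_lcancel_nat)
    then show "x = y" using \<open>x \<in> _\<close> \<open>y \<in> _\<close> by (simp add: cong_def)
  qed
  moreover have "(\<lambda>k. c * k mod M) ` {..<M} \<subseteq> {..<M}"
    using modulus_pos by auto
  ultimately have "bij_betw (\<lambda>k. c * k mod M) {..<M} {..<M}"
    by (simp add: bij_betw_def endo_inj_surj)
  then have "(\<Sum>k<M. chi k) = (\<Sum>k<M. chi (c * k mod M))"
    by (rule sum.reindex_bij_betw[symmetric])
  also have "\<dots> = - (\<Sum>k<M. chi k)"
    by (simp add: periodic mult c sum_negf)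
  finally show ?thesis by simp
qed

text \<open>Whole periods cancel, so induction strips them off until fewer than \<open>M\<close>
  terms of absolute value at most 1 remain.\<close>

lemma partial_sum_bound: "\<bar>\<Sum>i<k. chi i\<bar> \<le> M"
proof (induction k rule: less_induct)
  case (less k)
  show ?case
  proof (cases "k < M")
    case True
    have "\<bar>\<Sum>i<k. chi i\<bar> \<le> (\<Sum>i<k. \<bar>chi i\<bar>)" by (rule sum_abs)
    also have "\<dots> \<le> (\<Sum>i<k. 1)" by (intro sum_mono abs_le_1)
    finally show ?thesis using True by simp
  next
    case False
    then obtain j where j: "k = M + j" using le_Suc_ex not_less by blast
    have "(\<Sum>i<k. chi i) = (\<Sum>i<M. chi i) + (\<Sum>i<j. chi (i + M))"
      unfolding j by (induction j) (simp_all add: add.commute)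
    also have "\<dots> = (\<Sum>i<j. chi i)" by (simp add: sum_period add_modulus)
    finally show ?thesis using less.IH[of j] j modulus_pos by simp
  qed
qed

lemma interval_sum_bound: "\<bar>\<Sum>i\<in>{m..<k}. chi i\<bar> \<le> 2 * real M"
proof (cases "m \<le> k")
  case True
  then have "(\<Sum>i\<in>{m..<k}. chi i) = (\<Sum>i<k. chi i) - (\<Sum>i<m. chi i)"
    by (simp add: sum_diff_nat_ivl[of 0 m k, symmetric] lessThan_atLeast0)
  then show ?thesis
    using partial_sum_bound[of k] partial_sum_bound[of m] by linarith
qed simp

lemma weighted_sum_bound:
  assumes "\<And>i. m \<le> i \<Longrightarrow> g (Suc i) \<le> g i" "\<And>i. m \<le> i \<Longrightarrow> 0 \<le> g i"
  shows "\<bar>\<Sum>i\<in>{m..<n}. chi i * g i\<bar> \<le> 2 * real M * g m"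
proof (cases "m \<le> n")
  case True
  show ?thesis by (rule abel_bound[OF True]) (auto intro: interval_sum_bound assms)
qed (use assms(2)[of m] in simp)

end

text \<open>The index may start at 0 because \<open>0 powr - s = 0\<close>; this matters for modulus
  1, where \<open>chi 0 = 1\<close>.\<close>

definition L_series :: "(nat \<Rightarrow> real) \<Rightarrow> real \<Rightarrow> real"
  where "L_series chi s = (\<Sum>n. chi n * real n powr - s)"

section \<open>Convergence and tails of nonprincipal L-series for s > 0\<close>

context nonprincipal_real_char
begin

lemma dirichlet_interval_bound:
  assumes "s > 0" "m > 0"
  shows "\<bar>\<Sum>i\<in>{m..<n}. chi i * real i powr - s\<bar> \<le> 2 * real M * real m powr - s"
  using assms by (intro weighted_sum_bound) (auto intro!: powr_mono2')

lemma dirichlet_summable: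
  assumes "s > 0"
  shows "summable (\<lambda>n. chi n * real n powr - s)"
  unfolding summable_Cauchy
proof (intro allI impI)
  fix e :: real assume "e > 0"
  have "((\<lambda>m. 2 * real M * real m powr - s) \<longlongrightarrow> 2 * real M * 0) sequentially"
    by (intro tendsto_intros tendsto_neg_powr filterlim_real_sequentially) (use assms in auto)
  then have "\<forall>\<^sub>F m in sequentially. 2 * real M * real m powr - s < e"
    using \<open>e > 0\<close> by (auto dest: order_tendstoD)
  then obtain N where N: "\<And>m. m \<ge> N \<Longrightarrow> 2 * real M * real m powr - s < e"
    unfolding eventually_sequentially by blast
  \<comment> \<open>The threshold is \<open>Suc N\<close> because the interval bound needs a
    positive lower end.\<close>
  have "norm (sum (\<lambda>n. chi n * real n powr - s) {m..<n}) < e" if "m \<ge> Suc N" for m n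
    using dirichlet_interval_bound[OF assms, of m n] N[of m] that by simp
  then show "\<exists>N. \<forall>m\<ge>N. \<forall>n. norm (sum (\<lambda>n. chi n * real n powr - s) {m..<n}) < e"
    by blast
qed

lemma L_series_tail_bound:
  assumes "s > 0" "m > 0"
  shows "\<bar>L_series chi s - (\<Sum>i<m. chi i * real i powr - s)\<bar> \<le> 2 * real M * real m powr - s"
proof -
  let ?f = "\<lambda>i. chi i * real i powr - s"
  have "(\<lambda>n. \<bar>(\<Sum>i<n. ?f i) - (\<Sum>i<m. ?f i)\<bar>) \<longlonglongrightarrow> \<bar>L_series chi s - (\<Sum>i<m. ?f i)\<bar>"
    unfolding L_series_def using summable_LIMSEQ[OF dirichlet_summable[OF assms(1)]]
    by (intro tendsto_intros)
  moreover have "\<bar>(\<Sum>i<n. ?f i) - (\<Sum>i<m. ?f i)\<bar> \<le> 2 * real M * real m powr - s" if "n \<ge> m" for n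
    using dirichlet_interval_bound[OF assms, of n] that
    by (simp add: sum_diff_nat_ivl[of 0 m n, symmetric] lessThan_atLeast0)
  ultimately show ?thesis
    by (intro tendsto_upperbound[of _ _ sequentially]) (auto simp: eventually_sequentially)
qed

lemma L_series_le:
  assumes "s > 0"
  shows "L_series chi s \<le> 2 * real M"
  using L_series_tail_bound[OF assms, of 1] by simp

end

subsection \<open>Nonvanishing at 1\<close>

text \<open>AM-GM applied to the terms of index \<open>i\<close> and \<open>n - Suc i\<close>, whose
  geometric mean is always \<open>y ^ (n - 1)\<close>; adding the sum to its reversal forms all
  these pairs at once.\<close>

lemma geometric_sum_ge:
  fixes y :: real
  assumes "y > 0"
  shows "real n * y ^ (n - 1) \<le> (\<Sum>i<n. (y\<^sup>2) ^ i)"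
proof -
  have "2 * (real n * y ^ (n - 1)) = (\<Sum>i<n. 2 * y ^ (n - 1))"
    by simp
  also have "\<dots> \<le> (\<Sum>i<n. (y\<^sup>2) ^ i + (y\<^sup>2) ^ (n - Suc i))"
  proof (rule sum_mono)
    fix i assume "i \<in> {..<n}"
    then have "y ^ (n - 1) = y ^ i * y ^ (n - Suc i)"
      by (simp flip: power_add)
    moreover have "0 \<le> (y ^ i - y ^ (n - Suc i))\<^sup>2" by simp
    ultimately show "2 * y ^ (n - 1) \<le> (y\<^sup>2) ^ i + (y\<^sup>2) ^ (n - Suc i)"
      by (simp add: power2_diff power_mult[symmetric] mult.commute mult.left_commute)
  qed
  also have "\<dots> = (\<Sum>i<n. (y\<^sup>2) ^ i) + (\<Sum>i<n. (y\<^sup>2) ^ i)"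
    by (simp add: sum.distrib sum.nat_diff_reindex[where g = "\<lambda>i. (y\<^sup>2) ^ i"])
  finally show ?thesis by simp
qed

text \<open>The gap between a Lambert coefficient and its leading singular part as x tends to 1. The
  singular parts sum up to L(1) / (1 - x).\<close>

definition lambert_gap :: "real \<Rightarrow> nat \<Rightarrow> real"
  where "lambert_gap x n = 1 / (real n * (1 - x)) - x ^ n / (1 - x ^ n)"

lemma lambert_gap_nonneg:
  assumes "0 < x" "x < 1" "n > 0"
  shows "0 \<le> lambert_gap x n"
proof -
  have "real n * x ^ n \<le> (\<Sum>i<n. x ^ i)"
    using sum_bounded_below[of "{..<n}" "x ^ n" "\<lambda>i. x ^ i"] assms
    by (simp add: power_decreasing)
  then have "(1 - x) * (real n * x ^ n) \<le> 1 - x ^ n"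
    using assms by (simp add: one_diff_power_eq mult_left_mono)
  moreover have "x ^ n < 1" using assms by (simp add: power_less_one_iff)
  ultimately show ?thesis
    using assms by (simp add: lambert_gap_def divide_simps mult.commute mult.left_commute)
qed

text \<open>After the factor 1 - x is split off, the claim becomes n (n + 1) x^n <= S T. With y =
  sqrt x the AM-GM bounds S >= n y^(n - 1) and T >= (n + 1) y^n give it, since y^(2n - 1) >= y^(2n)
  = x^n.\<close>

lemma lambert_gap_decreasing:
  assumes "0 < x" "x < 1" "n > 0"
  shows "lambert_gap x (Suc n) \<le> lambert_gap x n"
proof -
  define S where "S = (\<Sum>i<n. x ^ i)"
  define T where "T = (\<Sum>i<Suc n. x ^ i)"
  define y where "y = sqrt x"
  have y: "0 < y" "y \<le> 1" "y\<^sup>2 = x" using assms by (auto simp: y_def)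
  have S: "1 - x ^ n = (1 - x) * S" and T: "1 - x ^ Suc n = (1 - x) * T"
    unfolding S_def T_def by (rule one_diff_power_eq)+
  have pos: "0 < S" "0 < T"
    unfolding S_def T_def by (intro sum_pos; use assms in auto)+
  have "real n * real (Suc n) * x ^ n = real n * real (Suc n) * y ^ (2 * n)"
    using y by (simp add: power_mult)
  also have "\<dots> \<le> real n * real (Suc n) * y ^ (2 * n - 1)"
    using y by (intro mult_left_mono power_decreasing) auto
  also have "\<dots> = (real n * y ^ (n - 1)) * (real (Suc n) * y ^ (Suc n - 1))"
  proof -
    have "2 * n - 1 = (n - 1) + (Suc n - 1)" using assms by simp
    then show ?thesis by (simp only: power_add mult_ac)
  qed
  also have "\<dots> \<le> S * T"
    using geometric_sum_ge[of y n] geometric_sum_ge[of y "Suc n"] y pos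
    unfolding S_def T_def by (intro mult_mono) auto
  finally have main: "x ^ n / (S * T) \<le> 1 / (real n * real (Suc n))"
    using pos assms by (simp add: divide_simps mult_ac)
  \<comment> \<open>This recursion reduces the numerator of x^n / S - x^(n + 1) / T to x^n (T - x S)
    = x^n.\<close>
  have TS: "T = 1 + x * S"
    unfolding S_def T_def by (subst sum.lessThan_Suc_shift) (simp add: sum_distrib_left)
  have "x ^ n / S - x ^ Suc n / T = x ^ n / (S * T)"
    using pos by (simp add: diff_divide_eq_iff divide_simps) (simp add: TS algebra_simps)
  moreover have "1 / real n - 1 / real (Suc n) = 1 / (real n * real (Suc n))"
    using assms by (simp add: divide_simps)
  ultimately have "0 \<le> (1 / real n - x ^ n / S) - (1 / real (Suc n) - x ^ Suc n / T)"
    using main by simp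
  then have "0 \<le> ((1 / real n - x ^ n / S) - (1 / real (Suc n) - x ^ Suc n / T)) / (1 - x)"
    using assms by simp
  also have "\<dots> = lambert_gap x n - lambert_gap x (Suc n)"
    unfolding lambert_gap_def S T by (simp add: diff_divide_distrib mult.commute)
  finally show ?thesis by simp
qed

text \<open>Both sides run over the pairs with d m <= N, grouped by \<open>d\<close> on the left and
  by the product k = d m on the right.\<close>

lemma sum_divisors_reindex:
  fixes f :: "nat \<Rightarrow> nat \<Rightarrow> real"
  shows "(\<Sum>d\<in>{1..N}. \<Sum>m\<in>{1..N div d}. f d m) = (\<Sum>k\<in>{1..N}. \<Sum>d | d dvd k. f d (k div d))"
proof -
  have "(\<Sum>d\<in>{1..N}. \<Sum>m\<in>{1..N div d}. f d m)
      = (\<Sum>(d, m)\<in>(SIGMA d:{1..N}. {1..N div d}). f d m)"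
    by (simp add: sum.Sigma)
  also have "\<dots> = (\<Sum>(k, d)\<in>(SIGMA k:{1..N}. {d. d dvd k}). f d (k div d))"
  proof (rule sum.reindex_bij_witness[of _ "\<lambda>(k, d). (d, k div d)" "\<lambda>(d, m). (d * m, d)"], goal_cases)
    case (2 a)
    obtain d m where a: "a = (d, m)" by force
    with 2 have "1 \<le> d" "1 \<le> m" "m \<le> N div d" by auto
    then have "d * m \<le> N"
      by (metis mult.commute div_times_less_eq_dividend le_trans mult_le_mono1)
    then show ?case using 2 a by auto
  next
    case (4 b)
    then obtain d m where b: "b = (d * m, d)" "0 < d" "0 < m" "d * m \<le> N"
      by (auto elim!: dvdE)
    have "d \<le> N" using b(3,4) le_trans[of d "d * m" N] by simp
    moreover have "m \<le> N div d"
      using b div_le_mono[of "d * m" N d] by simp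
    ultimately show ?case using b by auto
  qed (auto simp: elim!: dvdE)
  also have "\<dots> = (\<Sum>k\<in>{1..N}. \<Sum>d | d dvd k. f d (k div d))"
    by (rule sum.Sigma[symmetric]) auto
  finally show ?thesis .
qed

text \<open>The geometric expansion is kept finite with an exact remainder, so that Lambert sums can
  be regrouped without rearranging infinite series.\<close>

lemma lambert_term:
  fixes y :: real
  assumes "y \<noteq> 1"
  shows "y / (1 - y) = (\<Sum>m\<in>{1..Q}. y ^ m) + y ^ Suc Q / (1 - y)"
proof (induction Q)
  case (Suc Q)
  then show ?case using assms by (simp add: field_simps)
qed simp

text \<open>Splitting off the full power of one prime leaves a strictly smaller cofactor; this
  drives the inductions for multiplicative functions.\<close>

lemma exists_prime_decomposition:
  assumes "k > (1::nat)"
  obtains p e m where "prime p" "\<not> p dvd m" "k = p ^ e * m" "0 < m" "m < k"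
proof -
  obtain p where p: "prime p" "p dvd k" using assms prime_factor_nat[of k] by auto
  obtain m where m: "k = p ^ multiplicity p k * m" "\<not> p dvd m"
    using multiplicity_decompose'[of k p] assms p(1) by (metis not_prime_unit not_one_less_zero)
  have "multiplicity p k > 0" using p assms by (simp add: prime_multiplicity_gt_zero_iff)
  then have "1 < p ^ multiplicity p k" using prime_gt_1_nat[OF p(1)] by (metis one_less_power)
  moreover have "0 < m" using m(2) by (intro Nat.gr0I) auto
  ultimately have "m < k" using m(1) by (metis mult.commute mult_1_right nat_mult_less_cancel1)
  with that p m \<open>0 < m\<close> show ?thesis by blast
qed

section \<open>Divisor sums of a real character\<close>

context real_char
begin

text \<open>The Dirichlet convolution of \<open>chi\<close> with the constant 1; its values are the
  power series coefficients of the Lambert series of \<open>chi\<close>.\<close>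

definition divisor_sum :: "nat \<Rightarrow> real"
  where "divisor_sum k = (\<Sum>d | d dvd k. chi d)"

text \<open>Every divisor of p^e m is p^i d for exactly one i <= e and one divisor d of m, because p
  does not divide m.\<close>

lemma divisor_sum_prime_power_mult:
  assumes "prime p" "\<not> p dvd m"
  shows "divisor_sum (p ^ e * m) = (\<Sum>i\<le>e. chi p ^ i) * divisor_sum m"
proof -
  have "m > 0" using assms by (intro Nat.gr0I) auto
  have inj: "inj_on (\<lambda>(i, d). p ^ i * d) ({..e} \<times> {d. d dvd m})"
  proof (rule inj_onI, clarify)
    fix i d j d' assume *: "d dvd m" "d' dvd m" "p ^ i * d = p ^ j * d'"
    have "\<not> p dvd d" "\<not> p dvd d'"
      using * assms dvd_trans by blast+
    then have "coprime (p ^ i) d'" "coprime (p ^ j) d"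
      using assms(1) by (simp_all add: prime_imp_coprime)
    then have "p ^ i = p ^ j \<and> d = d'"
      using *(3) by (metis coprime_crossproduct_nat coprime_commute mult.commute)
    then show "i = j \<and> d = d'"
      using prime_gt_1_nat[OF assms(1)] by (simp add: power_inject_exp)
  qed
  have "{d. d dvd p ^ e * m} = (\<lambda>(i, d). p ^ i * d) ` ({..e} \<times> {d. d dvd m})"
  proof (intro equalityI subsetI)
    fix x assume "x \<in> {d. d dvd p ^ e * m}"
    then obtain u v where "x = u * v" "u dvd p ^ e" "v dvd m"
      using division_decomp[of x "p ^ e" m] by auto
    moreover then obtain i where "i \<le> e" "u = p ^ i"
      using divides_primepow_nat[OF assms(1)] by blast
    ultimately show "x \<in> (\<lambda>(i, d). p ^ i * d) ` ({..e} \<times> {d. d dvd m})"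
      by force
  qed (auto intro!: mult_dvd_mono le_imp_power_dvd)
  then have "divisor_sum (p ^ e * m) = (\<Sum>(i, d)\<in>{..e} \<times> {d. d dvd m}. chi p ^ i * chi d)"
    unfolding divisor_sum_def
    by (simp only: sum.reindex[OF inj]) (simp add: mult power case_prod_beta)
  also have "\<dots> = (\<Sum>i\<le>e. chi p ^ i) * divisor_sum m"
    unfolding divisor_sum_def by (simp add: sum_product sum.cartesian_product)
  finally show ?thesis .
qed

lemma chi_power_sum_nonneg: "0 \<le> (\<Sum>i\<le>e. chi p ^ i)"
proof -
  have *: "(\<Sum>i\<le>e. (-1::real) ^ i) = (if even e then 1 else 0)"
    by (induction e) auto
  show ?thesis using chi_cases[of p] * by (auto simp: power_0_left sum.delta)
qed

text \<open>If \<open>chi p = -1\<close> the sum alternates, and an even top exponent makes it end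
  on +1. This is why squares have divisor sum at least 1.\<close>

lemma chi_power_sum_even_ge_1: "1 \<le> (\<Sum>i\<le>2 * e. chi p ^ i)"
proof -
  have *: "(\<Sum>i\<le>2 * e. (-1::real) ^ i) = 1" for e
    by (induction e) auto
  show ?thesis using chi_cases[of p] *[of e] by (auto simp: power_0_left sum.delta)
qed

lemma divisor_sum_1: "divisor_sum (Suc 0) = 1"
  by (simp add: divisor_sum_def)

lemma divisor_sum_nonneg: "k > 0 \<Longrightarrow> 0 \<le> divisor_sum k"
proof (induction k rule: less_induct)
  case (less k)
  show ?case
  proof (cases "k = 1")
    case False
    with less.prems have "1 < k" by simp
    then obtain p e m where *: "prime p" "\<not> p dvd m" "k = p ^ e * m" "0 < m" "m < k"
      by (rule exists_prime_decomposition)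
    then show ?thesis
      using less.IH[of m] chi_power_sum_nonneg by (simp add: divisor_sum_prime_power_mult)
  qed (simp add: divisor_sum_1)
qed

lemma divisor_sum_square_ge_1: "k > 0 \<Longrightarrow> 1 \<le> divisor_sum (k\<^sup>2)"
proof (induction k rule: less_induct)
  case (less k)
  show ?case
  proof (cases "k = 1")
    case False
    with less.prems have "1 < k" by simp
    then obtain p e m where *: "prime p" "\<not> p dvd m" "k = p ^ e * m" "0 < m" "m < k"
      by (rule exists_prime_decomposition)
    have "k\<^sup>2 = p ^ (2 * e) * m\<^sup>2"
      using *(3) by (simp add: power_mult_distrib power_mult[symmetric] mult.commute)
    moreover have "\<not> p dvd m\<^sup>2" using * prime_dvd_power by blast
    ultimately have "divisor_sum (k\<^sup>2) = (\<Sum>i\<le>2 * e. chi p ^ i) * divisor_sum (m\<^sup>2)"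
      using *(1) by (simp add: divisor_sum_prime_power_mult)
    moreover have "1 * 1 \<le> (\<Sum>i\<le>2 * e. chi p ^ i) * divisor_sum (m\<^sup>2)"
      using less.IH[of m] * chi_power_sum_even_ge_1[of p e] by (intro mult_mono) linarith+
    ultimately show ?thesis by simp
  qed (simp add: divisor_sum_1)
qed

text \<open>Expanding each Lambert term up to total exponent N and collecting the powers of x gives
  the coefficients \<open>divisor_sum k\<close>, which are nonnegative and at least 1 at the
  squares. The subtracted term pays for the truncation of the N expansions.\<close>

lemma lambert_sum_ge:
  assumes x: "0 < x" "x < 1" and N: "K\<^sup>2 \<le> N"
  shows "(\<Sum>j\<in>{1..K}. x ^ (j\<^sup>2)) - real N * (x ^ N / (1 - x))
      \<le> (\<Sum>n\<in>{1..N}. chi n * (x ^ n / (1 - x ^ n)))"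
proof -
  have less1: "x ^ n < 1" if "n > 0" for n using x that by (simp add: power_less_one_iff)
  \<comment> \<open>The first omitted exponent n (N div n + 1) is at least N, and 1 - x^n >= 1 -
    x.\<close>
  have rem: "\<bar>chi n * ((x ^ n) ^ Suc (N div n) / (1 - x ^ n))\<bar> \<le> x ^ N / (1 - x)"
    if "n \<in> {1..N}" for n
  proof -
    have "N \<le> n * Suc (N div n)"
      using that dividend_less_times_div[of n N] by simp
    then have 1: "(x ^ n) ^ Suc (N div n) \<le> x ^ N"
      using x by (simp only: power_mult[symmetric]) (rule power_decreasing, auto)
    have 2: "1 - x \<le> 1 - x ^ n"
      using x that power_decreasing[of 1 n x] by simp
    have "(x ^ n) ^ Suc (N div n) / (1 - x ^ n) \<le> x ^ N / (1 - x)"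
      using 1 2 x by (intro frac_le) auto
    moreover have "0 \<le> (x ^ n) ^ Suc (N div n) / (1 - x ^ n)"
      using less1[of n] that x by simp
    moreover have "\<bar>chi n\<bar> * ((x ^ n) ^ Suc (N div n) / (1 - x ^ n)) \<le> 1 * ((x ^ n) ^ Suc (N div n) / (1 - x ^ n))"
      using calculation(2) by (intro mult_right_mono abs_le_1)
    moreover have "\<bar>chi n * ((x ^ n) ^ Suc (N div n) / (1 - x ^ n))\<bar>
        = \<bar>chi n\<bar> * ((x ^ n) ^ Suc (N div n) / (1 - x ^ n))"
      using calculation(2) by (simp only: abs_mult abs_of_nonneg)
    ultimately show ?thesis by linarith
  qed
  have "(\<Sum>j\<in>{1..K}. x ^ (j\<^sup>2)) \<le> (\<Sum>j\<in>{1..K}. x ^ (j\<^sup>2) * divisor_sum (j\<^sup>2))"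
    using x divisor_sum_square_ge_1 by (intro sum_mono) simp
  also have "\<dots> = (\<Sum>k\<in>(\<lambda>j. j\<^sup>2) ` {1..K}. x ^ k * divisor_sum k)"
    by (subst sum.reindex) (auto simp: inj_on_def)
  also have "\<dots> \<le> (\<Sum>k\<in>{1..N}. x ^ k * divisor_sum k)"
  proof (rule sum_mono2)
    show "(\<lambda>j. j\<^sup>2) ` {1..K} \<subseteq> {1..N}"
      using N by (auto intro: order_trans[OF power_mono])
  qed (use x divisor_sum_nonneg in auto)
  also have "\<dots> = (\<Sum>k\<in>{1..N}. \<Sum>d | d dvd k. chi d * (x ^ d) ^ (k div d))"
    unfolding divisor_sum_def sum_distrib_left
    by (intro sum.cong refl) (auto simp: power_mult[symmetric])
  also have "\<dots> = (\<Sum>n\<in>{1..N}. chi n * (\<Sum>m\<in>{1..N div n}. (x ^ n) ^ m))"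
    by (simp only: sum_divisors_reindex[where f = "\<lambda>d m. chi d * (x ^ d) ^ m", symmetric] sum_distrib_left)
  also have "\<dots> = (\<Sum>n\<in>{1..N}. chi n * (x ^ n / (1 - x ^ n)))
      - (\<Sum>n\<in>{1..N}. chi n * ((x ^ n) ^ Suc (N div n) / (1 - x ^ n)))"
    unfolding sum_subtractf[symmetric]
  proof (rule sum.cong)
    fix n assume "n \<in> {1..N}"
    then show "chi n * (\<Sum>m\<in>{1..N div n}. (x ^ n) ^ m) = chi n * (x ^ n / (1 - x ^ n))
        - chi n * ((x ^ n) ^ Suc (N div n) / (1 - x ^ n))"
      using less1[of n] by (subst lambert_term[of _ "N div n"]) (auto simp: algebra_simps)
  qed simp
  finally have "(\<Sum>j\<in>{1..K}. x ^ (j\<^sup>2)) \<le> (\<Sum>n\<in>{1..N}. chi n * (x ^ n / (1 - x ^ n)))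
      - (\<Sum>n\<in>{1..N}. chi n * ((x ^ n) ^ Suc (N div n) / (1 - x ^ n)))" .
  moreover have "\<bar>\<Sum>n\<in>{1..N}. chi n * ((x ^ n) ^ Suc (N div n) / (1 - x ^ n))\<bar> \<le> real N * (x ^ N / (1 - x))"
    using sum_bounded_above[of "{1..N}", OF rem] sum_abs[of _ "{1..N}"] by (fastforce intro: order_trans)
  ultimately show ?thesis by linarith
qed

end

context nonprincipal_real_char
begin

text \<open>Monsky's argument: as \<open>x \<rightarrow> 1\<close>, the Lambert series
  \<open>\<Sum> chi n x\<^sup>n / (1 - x\<^sup>n) = \<Sum> divisor_sum k x\<^sup>k\<close> dominates \<open>\<Sum> x^(j^2)\<close> and so is unbounded;
  on the other hand it differs from \<open>L(1) / (1 - x)\<close> by a sum weighted with the decreasing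
  \<open>lambert_gap x n\<close>, which Abel summation bounds by \<open>2 M\<close>.\<close>

lemma L_series_1_pos: "0 < L_series chi 1"
proof (rule ccontr)
  assume neg: "\<not> 0 < L_series chi 1"
  \<comment> \<open>As x tends to 1 the sum of K powers tends to K, which just exceeds the uniform
    bound 2 M.\<close>
  define K where "K = 2 * M + 1"
  have bound: "(\<Sum>j\<in>{1..K}. x ^ (j\<^sup>2)) \<le> 2 * real M" if x: "0 < x" "x < 1" for x :: real
  proof -
    let ?P = "\<lambda>N. \<Sum>i<Suc N. chi i * real i powr - 1"
    have ineq: "(\<Sum>j\<in>{1..K}. x ^ (j\<^sup>2)) \<le> ?P N / (1 - x) + 2 * real M + real N * (x ^ N / (1 - x))"
      if "N \<ge> K\<^sup>2" for N
    proof -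
      have "(\<Sum>n\<in>{1..N}. chi n * (x ^ n / (1 - x ^ n)))
          = (\<Sum>n\<in>{1..N}. chi n * real n powr - 1 / (1 - x)) - (\<Sum>n\<in>{1..N}. chi n * lambert_gap x n)"
        unfolding sum_subtractf[symmetric]
        by (intro sum.cong refl) (simp add: lambert_gap_def right_diff_distrib[of "chi _"] powr_minus divide_inverse mult.assoc)
      also have "(\<Sum>n\<in>{1..N}. chi n * real n powr - 1 / (1 - x)) = ?P N / (1 - x)"
        by (subst sum_divide_distrib[symmetric], subst sum.lessThan_Suc_shift)
           (simp add: sum.atLeast1_atMost_eq)
      finally have "(\<Sum>n\<in>{1..N}. chi n * (x ^ n / (1 - x ^ n)))
          = ?P N / (1 - x) - (\<Sum>n\<in>{1..N}. chi n * lambert_gap x n)" .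
      moreover have "\<bar>\<Sum>n\<in>{1..<Suc N}. chi n * lambert_gap x n\<bar> \<le> 2 * real M * lambert_gap x 1"
        using x by (intro weighted_sum_bound lambert_gap_decreasing lambert_gap_nonneg) auto
      \<comment> \<open>The first weight does not depend on x, so the Abel bound is uniform in
        x.\<close>
      moreover have "lambert_gap x 1 = 1"
        using x by (simp add: lambert_gap_def divide_simps)
      ultimately show ?thesis
        using lambert_sum_ge[OF x that] by (simp add: atLeastLessThanSuc_atLeastAtMost)
    qed
    \<comment> \<open>With x fixed, N tends to infinity: the truncation error vanishes, and the
      remaining singular term is at most 0 when L(1) <= 0.\<close>
    have "?P \<longlonglongrightarrow> L_series chi 1"
      unfolding L_series_def using LIMSEQ_Suc[OF summable_LIMSEQ[OF dirichlet_summable[of 1]]] by simp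
    moreover have "(\<lambda>N. real N * (x ^ N / (1 - x))) \<longlonglongrightarrow> 0 / (1 - x)"
      using tendsto_divide[OF powser_times_n_limit_0[of x] tendsto_const[of "1 - x"]] x by simp
    ultimately have "(\<lambda>N. ?P N / (1 - x) + 2 * real M + real N * (x ^ N / (1 - x)))
        \<longlonglongrightarrow> L_series chi 1 / (1 - x) + 2 * real M + 0 / (1 - x)"
      using x by (intro tendsto_intros) auto
    then have "(\<Sum>j\<in>{1..K}. x ^ (j\<^sup>2)) \<le> L_series chi 1 / (1 - x) + 2 * real M + 0 / (1 - x)"
      by (rule tendsto_lowerbound) (use ineq in \<open>auto simp: eventually_sequentially\<close>)
    moreover have "L_series chi 1 / (1 - x) \<le> 0"
      using neg x by (simp add: divide_nonpos_pos)
    ultimately show ?thesis by simp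
  qed
  have "((\<lambda>x::real. \<Sum>j\<in>{1..K}. x ^ (j\<^sup>2)) \<longlongrightarrow> (\<Sum>j\<in>{1..K}. 1 ^ (j\<^sup>2))) (at_left 1)"
    by (intro tendsto_intros)
  moreover have "\<forall>\<^sub>F x::real in at_left 1. (\<Sum>j\<in>{1..K}. x ^ (j\<^sup>2)) \<le> 2 * real M"
    using bound eventually_at_left_real[of 0 1] by (auto elim: eventually_mono)
  ultimately have "(\<Sum>j\<in>{1..K}. 1 ^ (j\<^sup>2)) \<le> 2 * real M"
    by (rule tendsto_upperbound) simp
  then show False by (simp add: K_def)
qed

text \<open>A fixed partial sum approximates the series uniformly for s >= 1 and is continuous in s,
  so near 1 the series stays between two positive constants.\<close>

lemma L_series_ln_bounded_near_1:
  obtains C where "\<forall>\<^sub>F s in at_right 1. \<bar>ln (L_series chi s)\<bar> \<le> C"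
proof -
  \<comment> \<open>L(1) = 4 d: one d is lost to the tail at 1, one to continuity and one to the
    tail at s, which leaves d as lower bound.\<close>
  define d where "d = L_series chi 1 / 4"
  have d: "d > 0" using L_series_1_pos by (simp add: d_def)
  define m where "m = Suc (nat \<lceil>2 * real M / d\<rceil>)"
  have m: "2 * real M * real m powr - s \<le> d" if "s \<ge> 1" for s
  proof -
    have "2 * real M / d \<le> real m" unfolding m_def by linarith
    then have "2 * real M / real m \<le> d"
      using d by (simp add: pos_divide_le_eq m_def mult.commute del: of_nat_Suc)
    then have "2 * real M * real m powr - 1 \<le> d"
      by (simp add: powr_minus divide_inverse)
    moreover have "real m powr - s \<le> real m powr - 1"
      using that by (intro powr_mono) (auto simp: m_def)
    then have "2 * real M * real m powr - s \<le> 2 * real M * real m powr - 1"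
      by (intro mult_left_mono) auto
    ultimately show ?thesis by simp
  qed
  let ?S = "\<lambda>s. \<Sum>i<m. chi i * real i powr - s"
  have tail: "\<bar>L_series chi s - ?S s\<bar> \<le> d" if "s \<ge> 1" for s
    proof -
    have "0 < s" "0 < m" using that by (simp_all add: m_def)
    then show ?thesis using L_series_tail_bound[of s m] m[OF that] by linarith
  qed
  have "(?S \<longlongrightarrow> ?S 1) (at_right 1)"
  proof (intro tendsto_sum tendsto_mult tendsto_const)
    fix i
    show "((\<lambda>s. real i powr - s) \<longlongrightarrow> real i powr - 1) (at_right 1)"
    proof (cases "i = 0")
      case False
      then show ?thesis by (intro tendsto_intros) auto
    qed simp
  qed
  moreover have "2 * d < ?S 1" proof -
    have "L_series chi 1 = 4 * d" by (simp add: d_def)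
    then show ?thesis using tail[OF order_refl] d by linarith
  qed
  ultimately have "\<forall>\<^sub>F s in at_right 1. 2 * d < ?S s"
    by (rule order_tendstoD)
  then have "\<forall>\<^sub>F s in at_right 1. \<bar>ln (L_series chi s)\<bar> \<le> \<bar>ln d\<bar> + \<bar>ln (2 * real M)\<bar>"
    using eventually_at_right_less[of 1]
  proof eventually_elim
    case (elim s)
    then have "d \<le> L_series chi s" using tail[of s] by simp
    moreover have "L_series chi s \<le> 2 * real M" using elim by (intro L_series_le) simp
    ultimately have "ln d \<le> ln (L_series chi s)" "ln (L_series chi s) \<le> ln (2 * real M)"
      using d by (auto intro: ln_mono)
    then show ?case by linarith
  qed
  with that show ?thesis by blast
qed

end

subsection \<open>Primes with prescribed real characters\<close>

text \<open>A sieve: \<open>F p\<close> times the current sum is its part over the multiples of p,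
  so the factor \<open>1 - F p\<close> deletes exactly these terms.\<close>

lemma suminf_remove_prime_multiples:
  fixes F :: "nat \<Rightarrow> real"
  assumes mult: "\<And>a b. F (a * b) = F a * F b" and summ: "summable (\<lambda>n. \<bar>F n\<bar>)"
    and "finite P" "\<And>p. p \<in> P \<Longrightarrow> prime p"
  shows "(\<Sum>n. F n) * (\<Prod>p\<in>P. 1 - F p) = (\<Sum>n. if \<forall>p\<in>P. \<not> p dvd n then F n else 0)"
  using assms(3,4)
proof (induction P rule: finite_induct)
  case (insert p P)
  define G where "G n = (if \<forall>q\<in>P. \<not> q dvd n then F n else 0)" for n
  have p: "prime p" using insert.prems by simp
  have G_summable: "summable G"
    by (rule summable_comparison_test[OF _ summ]) (auto simp: G_def)
  \<comment> \<open>The primes in \<open>P\<close> differ from p, so multiplying the index by p does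
    not change whether it has survived the sieve.\<close>
  have G_mult: "G (p * n) = F p * G n" for n
  proof -
    have "q dvd p * n \<longleftrightarrow> q dvd n" if "q \<in> P" for q
    proof -
      have "prime q" "q \<noteq> p" using that insert.prems insert.hyps(2) by auto
      then have "\<not> q dvd p" using p primes_dvd_imp_eq by blast
      then show ?thesis using \<open>prime q\<close> by (simp add: prime_dvd_mult_iff)
    qed
    then show ?thesis by (simp add: G_def mult)
  qed
  have "F p * (\<Sum>n. G n) = (\<Sum>n. G (p * n))"
    using suminf_mult[OF G_summable, of "F p"] by (simp add: G_mult)
  also have "\<dots> = (\<Sum>n. (\<lambda>m. if p dvd m then G m else 0) (p * n))"
    by simp
  also have "\<dots> = (\<Sum>n. if p dvd n then G n else 0)"
    by (rule suminf_mono_reindex) (use prime_gt_0_nat[OF p] in \<open>auto simp: strict_mono_def\<close>)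
  finally have "(\<Sum>n. G n) * (1 - F p) = (\<Sum>n. G n) - (\<Sum>n. if p dvd n then G n else 0)"
    by (simp add: algebra_simps)
  also have "\<dots> = (\<Sum>n. G n - (if p dvd n then G n else 0))"
    by (rule suminf_diff[OF G_summable])
       (rule summable_comparison_test[OF _ summ], auto simp: G_def)
  also have "\<dots> = (\<Sum>n. if \<forall>q\<in>insert p P. \<not> q dvd n then F n else 0)"
    by (intro suminf_cong) (auto simp: G_def)
  finally have step: "(\<Sum>n. G n) * (1 - F p) = (\<Sum>n. if \<forall>q\<in>insert p P. \<not> q dvd n then F n else 0)" .
  show ?case
  proof -
    have "(\<Sum>n. F n) * (\<Prod>q\<in>insert p P. 1 - F q) = ((\<Sum>n. F n) * (\<Prod>q\<in>P. 1 - F q)) * (1 - F p)"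
      using insert.hyps by simp
    also have "(\<Sum>n. F n) * (\<Prod>q\<in>P. 1 - F q) = (\<Sum>n. G n)"
      unfolding G_def by (rule insert.IH) (use insert.prems in simp)
    finally show ?thesis
      using step by simp
  qed
qed simp

text \<open>Once all primes up to N are sieved out, 1 is the only index up to N with a nonzero term,
  so the distance to 1 is at most a tail of the absolutely convergent series.\<close>

lemma euler_product:
  fixes F :: "nat \<Rightarrow> real"
  assumes mult: "\<And>a b. F (a * b) = F a * F b" and summ: "summable (\<lambda>n. \<bar>F n\<bar>)"
    and F0: "F 0 = 0" and F1: "F 1 = 1"
  shows "(\<lambda>N. (\<Sum>n. F n) * (\<Prod>p | prime p \<and> p \<le> N. 1 - F p)) \<longlonglongrightarrow> 1"
proof (rule LIMSEQ_I)
  fix r :: real assume "0 < r"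
  then obtain N0 where N0: "\<And>n. n \<ge> N0 \<Longrightarrow> norm (\<Sum>i. \<bar>F (i + n)\<bar>) < r"
    using suminf_exist_split[OF _ summ] by blast
  show "\<exists>no. \<forall>n\<ge>no. norm ((\<Sum>n. F n) * (\<Prod>p | prime p \<and> p \<le> n. 1 - F p) - 1) < r"
  proof (intro exI allI impI)
    fix N assume N: "Suc N0 \<le> N"
    define H where "H n = (if \<forall>p\<in>{p. prime p \<and> p \<le> N}. \<not> p dvd n then F n else 0)" for n
    have H_le: "\<bar>H n\<bar> \<le> \<bar>F n\<bar>" for n by (simp add: H_def)
    have H_summ: "summable (\<lambda>n. \<bar>H n\<bar>)"
      by (rule summable_comparison_test[OF _ summ]) (use H_le in auto)
    then have H_summ': "summable H" by (rule summable_rabs_cancel)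
    have small: "(\<Sum>i<Suc N. H i) = 1"
    proof -
      have "H i = (if i = 1 then 1 else 0)" if "i < Suc N" for i
      proof (cases "i = 0 \<or> i = 1")
        case True
        then show ?thesis
          using F0 F1 by (auto simp: H_def dest: prime_nat_iff[THEN iffD1])
      next
        case False
        then obtain p where "prime p" "p dvd i" using prime_factor_nat by blast
        moreover then have "p \<le> N" using that False dvd_imp_le[of p i] by simp
        ultimately show ?thesis using False by (auto simp: H_def)
      qed
      then have "(\<Sum>i<Suc N. H i) = (\<Sum>i<Suc N. if i = 1 then 1 else 0)"
        by (intro sum.cong) auto
      then show ?thesis using N by (simp add: sum.delta del: sum.lessThan_Suc)
    qed
    have "(\<Sum>n. F n) * (\<Prod>p | prime p \<and> p \<le> N. 1 - F p) - 1 = (\<Sum>n. H n) - (\<Sum>i<Suc N. H i)"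
      unfolding H_def[abs_def] small[unfolded H_def[abs_def]]
      by (subst suminf_remove_prime_multiples[OF mult summ]) auto
    also have "\<dots> = (\<Sum>i. H (i + Suc N))"
      using suminf_split_initial_segment[OF H_summ', of "Suc N"] by simp
    finally have "norm ((\<Sum>n. F n) * (\<Prod>p | prime p \<and> p \<le> N. 1 - F p) - 1)
        \<le> (\<Sum>i. \<bar>H (i + Suc N)\<bar>)"
      using summable_rabs[OF summable_ignore_initial_segment[OF H_summ, of "Suc N"]] by simp
    also have "\<dots> \<le> (\<Sum>i. \<bar>F (i + Suc N)\<bar>)"
      by (intro suminf_le summable_ignore_initial_segment H_summ summ H_le)
    also have "\<dots> < r" using N0[of "Suc N"] N by simp
    finally show "norm ((\<Sum>n. F n) * (\<Prod>p | prime p \<and> p \<le> N. 1 - F p) - 1) < r" .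
  qed
qed

section \<open>Logarithms of L-series as sums over primes\<close>

context real_char
begin

lemma dirichlet_abs_summable:
  assumes "s > 1"
  shows "summable (\<lambda>n. \<bar>chi n * real n powr - s\<bar>)"
proof (rule summable_comparison_test)
  show "summable (\<lambda>n. real n powr - s)"
    using assms by (simp add: summable_real_powr_iff)
  show "\<exists>N. \<forall>n\<ge>N. norm \<bar>chi n * real n powr - s\<bar> \<le> real n powr - s"
    using abs_le_1 by (auto simp: abs_mult intro!: mult_left_le_one_le)
qed

text \<open>The logarithm of the Euler product is the prime sum up to quadratic terms, and the
  squares of the summands are at most p^(-2). The 1 absorbs the truncation of the product; the error
  bound depends neither on s nor on the character.\<close>

lemma ln_L_series_prime_sum:
  assumes s: "s > 1"
  shows "0 < L_series chi s"
    and "\<forall>\<^sub>F N in sequentially. \<bar>ln (L_series chi s) - (\<Sum>p | prime p \<and> p \<le> N. chi p * real p powr - s)\<bar>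
      \<le> 2 * (\<Sum>n. real n powr - 2) + 1"
proof -
  define F where "F n = chi n * real n powr - s" for n
  define P where "P N = {p::nat. prime p \<and> p \<le> N}" for N
  let ?C = "\<Sum>n. real n powr - 2"
  have fin: "finite (P N)" for N by (simp add: P_def)
  have F_abs: "\<bar>F n\<bar> \<le> real n powr - s" for n
    using abs_le_1[of n] by (simp add: F_def abs_mult mult_left_le_one_le)
  \<comment> \<open>The estimate for ln (1 + x) - x requires |x| <= 1/2.\<close>
  have half: "\<bar>F p\<bar> \<le> 1 / 2" if "prime p" for p
  proof -
    have "real p powr - s \<le> real p powr - 1"
      using s prime_ge_1_nat[OF that] by (intro powr_mono) auto
    also have "\<dots> \<le> 1 / 2"
      using prime_ge_2_nat[OF that] by (simp add: powr_minus divide_simps)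
    finally show ?thesis using F_abs[of p] by linarith
  qed
  have prod_pos: "0 < (\<Prod>p\<in>P N. 1 - F p)" for N
  proof (intro prod_pos)
    fix p assume "p \<in> P N"
    then show "0 < 1 - F p" using half[of p] by (auto simp: P_def)
  qed
  have lim: "(\<lambda>N. L_series chi s * (\<Prod>p\<in>P N. 1 - F p)) \<longlonglongrightarrow> 1"
    unfolding L_series_def P_def F_def
    by (rule euler_product) (use dirichlet_abs_summable[OF s] in \<open>simp_all add: mult powr_mult mult_ac\<close>)
  then have "\<forall>\<^sub>F N in sequentially. 0 < L_series chi s * (\<Prod>p\<in>P N. 1 - F p)"
    by (rule order_tendstoD) simp
  then obtain N where "0 < L_series chi s * (\<Prod>p\<in>P N. 1 - F p)"
    using eventually_happens'[OF sequentially_bot] by blast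
  then show pos: "0 < L_series chi s"
    using prod_pos[of N] by (simp add: zero_less_mult_iff)
  have "(\<lambda>N. ln (L_series chi s * (\<Prod>p\<in>P N. 1 - F p))) \<longlonglongrightarrow> ln 1"
    by (rule tendsto_ln[OF lim]) simp
  from tendstoD[OF this, of 1]
  have "\<forall>\<^sub>F N in sequentially. \<bar>ln (L_series chi s * (\<Prod>p\<in>P N. 1 - F p))\<bar> < 1"
    by (simp add: dist_real_def)
  then show "\<forall>\<^sub>F N in sequentially. \<bar>ln (L_series chi s) - (\<Sum>p | prime p \<and> p \<le> N. chi p * real p powr - s)\<bar>
      \<le> 2 * ?C + 1"
  proof eventually_elim
    case (elim N)
    have "ln (L_series chi s * (\<Prod>p\<in>P N. 1 - F p)) = ln (L_series chi s) + (\<Sum>p\<in>P N. ln (1 - F p))"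
    proof -
      have "1 - F p > 0" if "p \<in> P N" for p using half[of p] that by (auto simp: P_def)
      then show ?thesis
        using pos prod_pos[of N] ln_prod[OF fin, of N "\<lambda>p. 1 - F p"] by (simp add: ln_mult_pos less_imp_neq)
    qed
    moreover have "\<bar>\<Sum>p\<in>P N. ln (1 - F p) + F p\<bar> \<le> 2 * ?C"
    proof -
      have "\<bar>ln (1 - F p) + F p\<bar> \<le> 2 * real p powr - 2" if "p \<in> P N" for p
      proof -
        have p: "prime p" using that by (simp add: P_def)
        have "\<bar>ln (1 + (- F p)) - (- F p)\<bar> \<le> 2 * (- F p)\<^sup>2"
          using half[OF p] by (intro abs_ln_one_plus_x_minus_x_bound) simp
        moreover have "(F p)\<^sup>2 \<le> real p powr - 2"
        proof -
          have "(F p)\<^sup>2 \<le> (real p powr - s)\<^sup>2"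
            using F_abs[of p] by (simp add: abs_le_square_iff[symmetric])
          also have "\<dots> = real p powr (- 2 * s)"
            using prime_gt_0_nat[OF p] by (simp add: power2_eq_square powr_add[symmetric])
          also have "\<dots> \<le> real p powr - 2"
            using s prime_ge_1_nat[OF p] by (intro powr_mono) auto
          finally show ?thesis .
        qed
        ultimately show ?thesis by simp
      qed
      then have "\<bar>\<Sum>p\<in>P N. ln (1 - F p) + F p\<bar> \<le> (\<Sum>p\<in>P N. 2 * real p powr - 2)"
        by (intro order_trans[OF sum_abs] sum_mono)
      also have "\<dots> = 2 * (\<Sum>p\<in>P N. real p powr - 2)" by (simp add: sum_distrib_left)
      also have "\<dots> \<le> 2 * ?C"
        by (intro mult_left_mono sum_le_suminf) (auto simp: fin summable_real_powr_iff)
      finally show ?thesis .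
    qed
    ultimately show ?case
      using elim unfolding sum.distrib F_def P_def by linarith
  qed
qed

end

section \<open>The principal character and orthogonality of real characters\<close>

definition principal_char :: "nat \<Rightarrow> nat \<Rightarrow> real"
  where "principal_char M k = (if coprime k M then 1 else 0)"

lemma real_char_principal:
  assumes "M > 0"
  shows "real_char M (principal_char M)"
  using assms by unfold_locales (auto simp: principal_char_def)

lemma real_char_cases:
  assumes "real_char M chi"
  shows "chi = principal_char M \<or> nonprincipal_real_char M chi"
proof (rule disjCI)
  interpret real_char M chi by fact
  assume "\<not> nonprincipal_real_char M chi"
  then have "chi c \<noteq> -1" for c
    using assms by (auto simp: nonprincipal_real_char_def nonprincipal_real_char_axioms_def)
  then show "chi = principal_char M"
    using coprime_cases not_coprime by (auto simp: principal_char_def fun_eq_iff)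
qed

text \<open>The indices k M + 1 are coprime to M and already give a divergent subseries at s = 1. A
  finite part of it that is large at 1 stays large for s near 1 by continuity.\<close>

lemma L_series_principal_unbounded:
  assumes M: "M > 0"
  shows "\<forall>\<^sub>F s in at_right 1. B < L_series (principal_char M) s"
proof -
  interpret real_char M "principal_char M" by (rule real_char_principal[OF M])
  have "\<not> summable (\<lambda>k. inverse (real (Suc (k * M))))"
  proof
    assume "summable (\<lambda>k. inverse (real (Suc (k * M))))"
    then have "summable (\<lambda>k. real M * inverse (real (Suc (k * M))))"
      by (rule summable_mult)
    moreover have "norm (inverse (real (Suc k))) \<le> real M * inverse (real (Suc (k * M)))" for k
    proof -
      have "real (Suc (k * M)) \<le> real M * real (Suc k)"
        using M by (simp add: algebra_simps flip: of_nat_mult of_nat_add of_nat_Suc)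
      then have "inverse (real M * real (Suc k)) \<le> inverse (real (Suc (k * M)))"
        by (rule le_imp_inverse_le) (simp del: of_nat_mult)
      then have "real M * inverse (real M * real (Suc k)) \<le> real M * inverse (real (Suc (k * M)))"
        by (intro mult_left_mono) auto
      moreover have "real M * inverse (real M * real (Suc k)) = inverse (real (Suc k))"
        using M by simp
      ultimately show ?thesis by (simp del: of_nat_Suc inverse_mult_distrib)
    qed
    ultimately have "summable (\<lambda>k. inverse (real (Suc k)))"
      by (intro summable_comparison_test[of "\<lambda>k. inverse (real (Suc k))"] exI allI impI)
    then show False
      using not_summable_harmonic[where 'a = real] summable_Suc_iff[of "\<lambda>k. inverse (real k)"] by simp
  qed
  then have "\<exists>K. B + 1 < (\<Sum>k<K. inverse (real (Suc (k * M))))"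
    using summableI_nonneg_bounded[of "\<lambda>k. inverse (real (Suc (k * M)))" "B + 1"]
    by (force simp: not_less simp del: of_nat_Suc)
  then obtain K where K: "B + 1 < (\<Sum>k<K. inverse (real (Suc (k * M))))" by blast
  have "((\<lambda>s. \<Sum>k<K. real (Suc (k * M)) powr - s) \<longlongrightarrow> (\<Sum>k<K. real (Suc (k * M)) powr - 1)) (at_right 1)"
    by (intro tendsto_sum tendsto_powr tendsto_const tendsto_minus tendsto_ident_at of_nat_neq_0)
  moreover have "B < (\<Sum>k<K. real (Suc (k * M)) powr - 1)"
    using K by (simp add: powr_minus)
  ultimately have "\<forall>\<^sub>F s in at_right 1. B < (\<Sum>k<K. real (Suc (k * M)) powr - s)"
    by (rule order_tendstoD)
  then show ?thesis
    using eventually_at_right_less[of 1]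
  proof eventually_elim
    case (elim s)
    have inj: "inj_on (\<lambda>k. Suc (k * M)) {..<K}" using M by (auto simp: inj_on_def)
    have "gcd M (k * M + 1) = 1" for k
      using gcd_add_mult[of M k 1] by simp
    then have "coprime (Suc (k * M)) M" for k
      by (metis Suc_eq_plus1 coprime_iff_gcd_eq_1 gcd.commute)
    then have "(\<Sum>k<K. real (Suc (k * M)) powr - s)
        = (\<Sum>n\<in>(\<lambda>k. Suc (k * M)) ` {..<K}. principal_char M n * real n powr - s)"
      by (simp add: sum.reindex[OF inj] principal_char_def)
    also have "\<dots> \<le> L_series (principal_char M) s"
      unfolding L_series_def
      by (rule sum_le_suminf[OF summable_rabs_cancel[OF dirichlet_abs_summable[OF elim(2)]]])
         (auto simp: principal_char_def)
    finally show ?case using elim by simp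
  qed
qed

lemma real_char_mult:
  assumes "real_char M chi" "real_char M psi"
  shows "real_char M (\<lambda>k. chi k * psi k)"
proof -
  interpret a: real_char M chi by fact
  interpret b: real_char M psi by fact
  show ?thesis
  proof
    fix k assume "coprime k M"
    then show "chi k * psi k = 1 \<or> chi k * psi k = - 1"
      using a.coprime_cases[of k] b.coprime_cases[of k] by auto
  next
    show "\<not> coprime k M \<Longrightarrow> chi k * psi k = 0" for k
      by (simp add: a.not_coprime)
  qed (simp_all add: a.modulus_pos a.mult b.mult a.periodic b.periodic)
qed

text \<open>Periodicity determines a character by its values below M, and each of these is 1, -1 or
  0.\<close>

lemma finite_real_chars: "finite {chi. real_char M chi}"
proof (rule finite_imageD)
  have "(\<lambda>chi. restrict chi {..<M}) ` {chi. real_char M chi} \<subseteq> PiE {..<M} (\<lambda>_. {1, -1, 0})"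
  proof (rule image_subsetI)
    fix chi assume "chi \<in> {chi. real_char M chi}"
    then interpret real_char M chi by simp
    show "restrict chi {..<M} \<in> PiE {..<M} (\<lambda>_. {1, -1, 0})"
      using chi_cases by (intro restrict_PiE_iff[THEN iffD2]) blast
  qed
  then show "finite ((\<lambda>chi. restrict chi {..<M}) ` {chi. real_char M chi})"
    by (rule finite_subset) (simp add: finite_PiE)
  show "inj_on (\<lambda>chi. restrict chi {..<M}) {chi. real_char M chi}"
  proof (rule inj_onI, clarify)
    fix chi psi assume *: "real_char M chi" "real_char M psi" "restrict chi {..<M} = restrict psi {..<M}"
    show "chi = psi"
    proof
      fix k
      have "k mod M < M" using real_char.modulus_pos[OF *(1)] by simp
      then have "chi (k mod M) = psi (k mod M)"
        using fun_cong[OF *(3), of "k mod M"] by simp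
      then show "chi k = psi k"
        using real_char.periodic[OF *(1), of k] real_char.periodic[OF *(2), of k] by simp
    qed
  qed
qed

text \<open>Multiplication by \<open>psi\<close> is an involution on the real characters and changes
  each summand by the factor \<open>psi c * psi p = -1\<close>.\<close>

lemma real_chars_orthogonal:
  assumes "coprime c M" "real_char M psi" "psi p \<noteq> psi c" "coprime p M"
  shows "(\<Sum>chi | real_char M chi. chi c * chi p) = 0"
proof -
  interpret psi: real_char M psi by fact
  have sq: "psi k * (psi k * chi k) = chi k" if "real_char M chi" for chi k
    using psi.coprime_cases[of k] real_char.not_coprime[OF that, of k] by (cases "coprime k M") auto
  have "(\<Sum>chi | real_char M chi. chi c * chi p)
      = (\<Sum>chi | real_char M chi. (psi c * chi c) * (psi p * chi p))"
    by (rule sum.reindex_bij_witness[of _ "\<lambda>chi k. psi k * chi k" "\<lambda>chi k. psi k * chi k"])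
       (auto simp: real_char_mult[OF assms(2)] sq)
  also have "\<dots> = (\<Sum>chi | real_char M chi. - (chi c * chi p))"
  proof (rule sum.cong)
    have "psi c * psi p = -1"
      using psi.coprime_cases[OF assms(1)] psi.coprime_cases[OF assms(4)] assms(3) by auto
    moreover have "(psi c * chi c) * (psi p * chi p) = (psi c * psi p) * (chi c * chi p)" for chi
      by (simp only: mult_ac)
    ultimately show "(psi c * chi c) * (psi p * chi p) = - (chi c * chi p)" for chi
      by simp
  qed simp
  finally show ?thesis by (simp add: sum_negf)
qed

text \<open>Dirichlet's argument within the real characters. If no prime matched c, orthogonality
  would cancel all prime sums in the combination of the ln L(s, chi) with coefficients chi(c),
  keeping it bounded as s decreases to 1; but its principal term is unbounded and all other terms
  are bounded.\<close>

theorem exists_prime_same_real_chars: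
  assumes M: "M > 0" and c: "coprime c M"
  shows "\<exists>p. prime p \<and> coprime p M \<and> (\<forall>chi. real_char M chi \<longrightarrow> chi p = chi c)"
proof (rule ccontr)
  assume "\<not> ?thesis"
  then have none: "\<exists>chi. real_char M chi \<and> chi p \<noteq> chi c" if "prime p" "coprime p M" for p
    using that by blast
  define X where "X = {chi. real_char M chi}"
  define D where "D = 2 * (\<Sum>n. real n powr - 2) + 1"
  define chi0 where "chi0 = principal_char M"
  have fin: "finite X" unfolding X_def by (rule finite_real_chars)
  have chi0: "chi0 \<in> X" using real_char_principal[OF M] by (simp add: X_def chi0_def)
  \<comment> \<open>Primes dividing M are covered too, since every character vanishes there.\<close>
  have orth: "(\<Sum>chi\<in>X. chi c * chi p) = 0" if "prime p" for p
  proof (cases "coprime p M")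
    case True
    then show ?thesis
      using none[OF that True] real_chars_orthogonal[OF c] unfolding X_def by blast
  next
    case False
    then show ?thesis
      by (intro sum.neutral) (auto simp: X_def dest: real_char.not_coprime)
  qed
  have total: "\<bar>\<Sum>chi\<in>X. chi c * ln (L_series chi s)\<bar> \<le> card X * D" if s: "s > 1" for s
  proof -
    let ?S = "\<lambda>chi N. \<Sum>p | prime p \<and> p \<le> N. chi p * real p powr - s"
    have "\<forall>\<^sub>F N in sequentially. \<forall>chi\<in>X. \<bar>ln (L_series chi s) - ?S chi N\<bar> \<le> D"
      unfolding D_def using real_char.ln_L_series_prime_sum(2)[OF _ s]
      by (intro eventually_ball_finite[OF fin]) (auto simp: X_def)
    then obtain N where N: "\<And>chi. chi \<in> X \<Longrightarrow> \<bar>ln (L_series chi s) - ?S chi N\<bar> \<le> D"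
      using eventually_happens'[OF sequentially_bot] by blast
    have "(\<Sum>chi\<in>X. chi c * ?S chi N)
        = (\<Sum>p | prime p \<and> p \<le> N. (\<Sum>chi\<in>X. chi c * chi p) * real p powr - s)"
      unfolding sum_distrib_left sum_distrib_right by (subst sum.swap) (simp add: mult_ac)
    also have "\<dots> = 0" by (intro sum.neutral) (simp add: orth)
    finally have "(\<Sum>chi\<in>X. chi c * ln (L_series chi s))
        = (\<Sum>chi\<in>X. chi c * (ln (L_series chi s) - ?S chi N))"
      by (simp add: right_diff_distrib sum_subtractf)
    also have "\<bar>\<dots>\<bar> \<le> (\<Sum>chi\<in>X. \<bar>chi c * (ln (L_series chi s) - ?S chi N)\<bar>)"
      by (rule sum_abs)
    also have "\<dots> \<le> (\<Sum>chi\<in>X. 1 * D)"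
    proof (rule sum_mono)
      fix chi assume chi: "chi \<in> X"
      then show "\<bar>chi c * (ln (L_series chi s) - ?S chi N)\<bar> \<le> 1 * D"
        using N[OF chi] real_char.abs_le_1[of M chi c] unfolding abs_mult X_def
        by (intro mult_mono) auto
    qed
    finally show ?thesis by simp
  qed
  have "\<exists>C. \<forall>\<^sub>F s in at_right 1. \<bar>ln (L_series chi s)\<bar> \<le> C" if "chi \<in> X - {chi0}" for chi
    using that real_char_cases[of M chi] nonprincipal_real_char.L_series_ln_bounded_near_1[of M chi]
    unfolding X_def chi0_def by blast
  then obtain C where C: "\<And>chi. chi \<in> X - {chi0} \<Longrightarrow> \<forall>\<^sub>F s in at_right 1. \<bar>ln (L_series chi s)\<bar> \<le> C chi"
    using bchoice[of "X - {chi0}" "\<lambda>chi C. \<forall>\<^sub>F s in at_right 1. \<bar>ln (L_series chi s)\<bar> \<le> C"] by blast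
  define B where "B = card X * D + (\<Sum>chi\<in>X - {chi0}. C chi)"
  have "\<forall>\<^sub>F s in at_right 1. \<forall>chi\<in>X - {chi0}. \<bar>ln (L_series chi s)\<bar> \<le> C chi"
    by (rule eventually_ball_finite) (use fin C in auto)
  moreover have "\<forall>\<^sub>F s in at_right 1. exp B < L_series chi0 s"
    unfolding chi0_def by (rule L_series_principal_unbounded[OF M])
  moreover have "\<forall>\<^sub>F s::real in at_right 1. 1 < s"
    by (rule eventually_at_right_less)
  ultimately have "\<forall>\<^sub>F s::real in at_right 1. False"
  proof eventually_elim
    case (elim s)
    have "(\<Sum>chi\<in>X. chi c * ln (L_series chi s))
        = ln (L_series chi0 s) + (\<Sum>chi\<in>X - {chi0}. chi c * ln (L_series chi s))"
      using c by (simp add: sum.remove[OF fin chi0]) (simp add: chi0_def principal_char_def)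
    moreover have "\<bar>\<Sum>chi\<in>X - {chi0}. chi c * ln (L_series chi s)\<bar> \<le> (\<Sum>chi\<in>X - {chi0}. C chi)"
    proof (rule order_trans[OF sum_abs sum_mono])
      fix chi assume chi: "chi \<in> X - {chi0}"
      then have "\<bar>chi c * ln (L_series chi s)\<bar> \<le> 1 * \<bar>ln (L_series chi s)\<bar>"
        unfolding abs_mult using real_char.abs_le_1[of M chi c]
        by (intro mult_right_mono) (auto simp: X_def)
      also have "\<dots> \<le> C chi" using elim chi by simp
      finally show "\<bar>chi c * ln (L_series chi s)\<bar> \<le> C chi" .
    qed
    ultimately have "ln (L_series chi0 s) \<le> B"
      using total[OF elim(3)] unfolding B_def by linarith
    moreover have "B < ln (L_series chi0 s)"
      using elim(2) using ln_less_cancel_iff[of "exp B" "L_series chi0 s"] less_trans[OF exp_gt_zero[of B]] by simp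
    ultimately show ?case by simp
  qed
  then show False by (simp add: trivial_limit_at_right_real eventually_False)
qed

subsection \<open>Ternary forms and Legendre symbols\<close>

text \<open>Davenport--Cassels: the line through the rational point and the nearest integer point meets
  the sphere again in a point with smaller denominator \<open>t'\<close>.\<close>

lemma three_rational_squares_descent:
  fixes n t x y z :: int
  assumes "t > 0" "n * t\<^sup>2 = x\<^sup>2 + y\<^sup>2 + z\<^sup>2"
  shows "\<exists>x y z. n = x\<^sup>2 + y\<^sup>2 + z\<^sup>2"
  using assms
proof (induction "nat t" arbitrary: t x y z rule: less_induct)
  case less
  have near: "\<exists>q. 4 * (u - t * q)\<^sup>2 \<le> t\<^sup>2" for u
  proof
    \<comment> \<open>Here q is u / t rounded to a nearest integer, so |u - t q| <= t / 2.\<close>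
    define q where "q = (2 * u + t) div (2 * t)"
    have "2 * t * q \<le> 2 * u + t" "2 * u + t < 2 * t * q + 2 * t"
      unfolding q_def using less.prems(1) pos_mod_bound[of "2 * t" "2 * u + t"]
        pos_mod_sign[of "2 * t" "2 * u + t"]
      by (simp_all add: minus_mod_eq_mult_div[symmetric])
    then have "\<bar>2 * (u - t * q)\<bar> \<le> \<bar>t\<bar>"
      using less.prems(1) by (simp add: algebra_simps)
    then have "(2 * (u - t * q))\<^sup>2 \<le> t\<^sup>2"
      by (simp only: abs_le_square_iff)
    then show "4 * (u - t * q)\<^sup>2 \<le> t\<^sup>2" by (simp only: power_mult_distrib) simp
  qed
  obtain X Y Z where X: "4 * (x - t * X)\<^sup>2 \<le> t\<^sup>2" and Y: "4 * (y - t * Y)\<^sup>2 \<le> t\<^sup>2"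
    and Z: "4 * (z - t * Z)\<^sup>2 \<le> t\<^sup>2"
    using near by meson
  \<comment> \<open>The line through (x, y, z) / t and (X, Y, Z) meets the sphere again at (a x + b
    X, a y + b Y, a z + b Z) / t'.\<close>
  define a where "a = X\<^sup>2 + Y\<^sup>2 + Z\<^sup>2 - n"
  define b where "b = 2 * (n * t - (x * X + y * Y + z * Z))"
  define t' where "t' = a * t + b"
  have R: "(x - t * X)\<^sup>2 + (y - t * Y)\<^sup>2 + (z - t * Z)\<^sup>2 = t * t'"
  proof -
    have "(x - t * X)\<^sup>2 + (y - t * Y)\<^sup>2 + (z - t * Z)\<^sup>2
        = (x\<^sup>2 + y\<^sup>2 + z\<^sup>2) - 2 * t * (x * X + y * Y + z * Z) + t\<^sup>2 * (X\<^sup>2 + Y\<^sup>2 + Z\<^sup>2)"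
      by (simp add: power2_eq_square algebra_simps)
    also have "\<dots> = t * t'"
      unfolding less.prems(2)[symmetric] t'_def a_def b_def
      by (simp add: power2_eq_square algebra_simps)
    finally show ?thesis .
  qed
  have sq: "(a * x + b * X)\<^sup>2 + (a * y + b * Y)\<^sup>2 + (a * z + b * Z)\<^sup>2 = n * t'\<^sup>2"
  proof -
    have "(a * x + b * X)\<^sup>2 + (a * y + b * Y)\<^sup>2 + (a * z + b * Z)\<^sup>2
        = a\<^sup>2 * (x\<^sup>2 + y\<^sup>2 + z\<^sup>2) + a * b * (2 * (x * X + y * Y + z * Z)) + b\<^sup>2 * (X\<^sup>2 + Y\<^sup>2 + Z\<^sup>2)"
      by (simp add: power2_eq_square algebra_simps)
    also have "2 * (x * X + y * Y + z * Z) = 2 * n * t - b"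
      by (simp add: b_def)
    also have "X\<^sup>2 + Y\<^sup>2 + Z\<^sup>2 = a + n"
      by (simp add: a_def)
    finally show ?thesis
      unfolding less.prems(2)[symmetric] t'_def by (simp add: power2_eq_square algebra_simps)
  qed
  have "0 \<le> t * t'" unfolding R[symmetric] by simp
  then have "0 \<le> t'" using less.prems(1) by (simp add: zero_le_mult_iff)
  \<comment> \<open>Three squares of at most t^2 / 4 each add up to less than t^2; this makes the
    new denominator smaller than t.\<close>
  have "4 * (A + B + C) \<le> 3 * T" if "4 * A \<le> T" "4 * B \<le> T" "4 * C \<le> T" for A B C T :: int
    using that by simp
  from this[OF X Y Z] have "4 * (t * t') \<le> 3 * t\<^sup>2" unfolding R .
  then have "t * (4 * t') \<le> t * (3 * t)" by (simp add: power2_eq_square algebra_simps)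
  then have "4 * t' \<le> 3 * t" using less.prems(1) by simp
  show ?case
  proof (cases "t' = 0")
    case True
    then have "x = t * X" "y = t * Y" "z = t * Z"
      using R by (auto simp: add_nonneg_eq_0_iff)
    then have "t\<^sup>2 * n = t\<^sup>2 * (X\<^sup>2 + Y\<^sup>2 + Z\<^sup>2)"
      using less.prems(2) by (simp add: algebra_simps power_mult_distrib)
    then show ?thesis using less.prems(1) by auto
  next
    case False
    show ?thesis
      by (rule less.hyps[of t', OF _ _ sq[symmetric]])
         (use False \<open>0 \<le> t'\<close> \<open>4 * t' \<le> 3 * t\<close> less.prems(1) in auto)
  qed
qed

text \<open>Pigeonhole in a box with sides \<open>\<lceil>\<surd>m\<rceil>\<close>, \<open>\<lceil>\<surd>n\<rceil>\<close>, \<open>\<lceil>\<surd>(m n)\<rceil>\<close>.\<close>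

lemma small_solution_of_congruence:
  fixes m n :: nat and r s :: int
  assumes "m > 0" "n > 0" and nonsquare: "\<And>k. k\<^sup>2 \<noteq> m * n"
  obtains x y z :: int where "(x, y, z) \<noteq> (0, 0, 0)" "x\<^sup>2 < int m" "y\<^sup>2 < int n" "z\<^sup>2 < int (m * n)"
    "int (m * n) dvd z - r * x - s * y"
proof -
  define side where "side k = (LEAST j::nat. k \<le> j\<^sup>2)" for k :: nat
  have side: "k \<le> (side k)\<^sup>2" for k
    unfolding side_def by (rule LeastI[of _ k]) (simp add: power2_eq_square)
  have below: "j\<^sup>2 < k" if "j < side k" for j k
    using not_less_Least[of j "\<lambda>j. k \<le> j\<^sup>2"] that by (simp add: side_def)
  define Box where "Box = {..<side m} \<times> {..<side n} \<times> {..<side (m * n)}"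
  define f where "f = (\<lambda>(x, y, z). (int z - r * int x - s * int y) mod int (m * n))"
  have pos: "m * n > 0" using assms by simp
  have "m * n < side m * side n * side (m * n)"
  proof -
    have "m * n \<le> (side m)\<^sup>2 * (side n)\<^sup>2"
      by (intro mult_le_mono side)
    \<comment> \<open>As m n is no square, rounding up its root is strict, so the box has more
      points than there are residues modulo m n.\<close>
    moreover have "m * n < (side (m * n))\<^sup>2"
      using side[of "m * n"] nonsquare[of "side (m * n)"] by linarith
    ultimately have "(m * n) * (m * n) < ((side m)\<^sup>2 * (side n)\<^sup>2) * (side (m * n))\<^sup>2"
      using pos by (intro mult_le_less_imp_less) auto
    then have "(m * n)\<^sup>2 < (side m * side n * side (m * n))\<^sup>2"
      by (simp add: power2_eq_square mult_ac)
    then show ?thesis by (rule power_less_imp_less_base) simp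
  qed
  then have "card Box > m * n" by (simp add: Box_def mult.assoc)
  moreover have "f ` Box \<subseteq> {0..<int (m * n)}"
    using pos by (auto simp: f_def)
  then have "card (f ` Box) \<le> m * n"
    using card_mono[of "{0..<int (m * n)}" "f ` Box"] by (simp del: of_nat_mult)
  ultimately have "\<not> inj_on f Box" by (intro pigeonhole) simp
  then obtain p q where pq: "p \<in> Box" "q \<in> Box" "p \<noteq> q" "f p = f q"
    unfolding inj_on_def by blast
  obtain x y z x' y' z' where p: "p = (x, y, z)" and q: "q = (x', y', z')"
    by (metis prod_cases3)
  have diff: "(int i - int j)\<^sup>2 < int k" if "i < side k" "j < side k" for i j k
  proof -
    have "nat \<bar>int i - int j\<bar> < side k" using that by simp
    from below[OF this] have "int ((nat \<bar>int i - int j\<bar>)\<^sup>2) < int k" by (simp only: of_nat_less_iff)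
    then show ?thesis by simp
  qed
  show ?thesis
  proof (rule that)
    show "(int x - int x', int y - int y', int z - int z') \<noteq> (0, 0, 0)"
      using pq(3) by (simp add: p q)
    show "(int x - int x')\<^sup>2 < int m" "(int y - int y')\<^sup>2 < int n" "(int z - int z')\<^sup>2 < int (m * n)"
      using pq(1,2) by (auto simp: p q Box_def intro!: diff simp del: of_nat_mult)
    have "int (m * n) dvd (int z - r * int x - s * int y) - (int z' - r * int x' - s * int y')"
      using pq(4) by (simp add: p q f_def mod_eq_dvd_iff)
    then show "int (m * n) dvd (int z - int z') - r * (int x - int x') - s * (int y - int y')"
      by (simp add: algebra_simps)
  qed
qed

text \<open>A small vector with z = \<alpha> x mod m and z = \<beta> y mod n makes Q = z^2 + m y^2 -
  n x^2 divisible by m n, while its size forces -m n < Q < 2 m n. So Q is 0 or m n, and the second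
  case is converted into a zero.\<close>

lemma legendre_equation_solvable:
  fixes m n :: nat and \<alpha> \<beta> :: int
  assumes pos: "m > 0" "n > 0" and cop: "coprime m n" and nonsquare: "\<And>k. k\<^sup>2 \<noteq> m * n"
    and \<alpha>: "[\<alpha>\<^sup>2 = int n] (mod int m)" and \<beta>: "[\<beta>\<^sup>2 = - int m] (mod int n)"
  obtains x y z :: int where "x \<noteq> 0" "int n * x\<^sup>2 = z\<^sup>2 + int m * y\<^sup>2"
proof -
  have copi: "coprime (int m) (int n)" using cop by simp
  obtain r where r: "[r = \<alpha>] (mod int m)" "[r = 0] (mod int n)"
    using binary_chinese_remainder_int[OF copi] by blast
  obtain s where s: "[s = 0] (mod int m)" "[s = \<beta>] (mod int n)"
    using binary_chinese_remainder_int[OF copi] by blast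
  obtain x y z where xyz: "(x, y, z) \<noteq> (0, 0, 0)" "x\<^sup>2 < int m" "y\<^sup>2 < int n" "z\<^sup>2 < int (m * n)"
    "int (m * n) dvd z - r * x - s * y"
    using small_solution_of_congruence[OF pos nonsquare] by blast
  define Q where "Q = z\<^sup>2 + int m * y\<^sup>2 - int n * x\<^sup>2"
  have z: "[z = r * x + s * y] (mod int (m * n))"
    using xyz(5) by (simp add: cong_iff_dvd_diff algebra_simps)
  have "[z = \<alpha> * x + 0 * y] (mod int m)"
    using cong_trans[OF cong_dvd_modulus[OF z] cong_add[OF cong_mult[OF r(1) cong_refl] cong_mult[OF s(1) cong_refl]]]
    by simp
  then have "[z\<^sup>2 = \<alpha>\<^sup>2 * x\<^sup>2] (mod int m)"
    using cong_pow[of z "\<alpha> * x" "int m" 2] by (simp add: power_mult_distrib)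
  then have "[z\<^sup>2 = int n * x\<^sup>2] (mod int m)"
    by (rule cong_trans) (rule cong_mult[OF \<alpha> cong_refl])
  then have "int m dvd z\<^sup>2 - int n * x\<^sup>2"
    by (simp only: cong_iff_dvd_diff)
  then have mQ: "int m dvd Q"
    using dvd_add[of "int m" "z\<^sup>2 - int n * x\<^sup>2" "int m * y\<^sup>2"] by (simp add: Q_def algebra_simps)
  have "[z = 0 * x + \<beta> * y] (mod int n)"
    using cong_trans[OF cong_dvd_modulus[OF z] cong_add[OF cong_mult[OF r(2) cong_refl] cong_mult[OF s(2) cong_refl]]]
    by simp
  then have "[z\<^sup>2 = \<beta>\<^sup>2 * y\<^sup>2] (mod int n)"
    using cong_pow[of z "\<beta> * y" "int n" 2] by (simp add: power_mult_distrib)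
  then have "[z\<^sup>2 = - int m * y\<^sup>2] (mod int n)"
    by (rule cong_trans) (rule cong_mult[OF \<beta> cong_refl])
  then have "int n dvd z\<^sup>2 + int m * y\<^sup>2"
    by (simp add: cong_iff_dvd_diff)
  then have "int n dvd Q"
    by (simp add: Q_def)
  with mQ have "int m * int n dvd Q"
    by (intro divides_mult copi)
  then obtain k where k: "Q = int (m * n) * k" by (auto elim: dvdE)
  have mn: "int (m * n) > 0" using pos by simp
  have "int n * x\<^sup>2 < int (m * n)" "int m * y\<^sup>2 < int (m * n)"
    using xyz(2,3) pos by (simp_all add: mult.commute[of "int m"])
  moreover have "0 \<le> int n * x\<^sup>2" "0 \<le> int m * y\<^sup>2" by simp_all
  ultimately have "- int (m * n) < Q" "Q < 2 * int (m * n)"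
    using xyz(4) zero_le_power2[of z] unfolding Q_def by linarith+
  then have "int (m * n) * (-1) < int (m * n) * k" "int (m * n) * k < int (m * n) * 2"
    unfolding k by simp_all
  then have "-1 < k" "k < 2"
    using mn by (simp_all only: mult_less_cancel_left_pos)
  then consider "k = 0" | "k = 1" by linarith
  then show ?thesis
  proof cases
    case 1
    then have eq: "int n * x\<^sup>2 = z\<^sup>2 + int m * y\<^sup>2" using k by (simp add: Q_def)
    have "x \<noteq> 0"
    proof
      assume "x = 0"
      then have "z\<^sup>2 + int m * y\<^sup>2 = 0" using eq by simp
      then have "z = 0" "y = 0" using pos by (auto simp: add_nonneg_eq_0_iff)
      with \<open>x = 0\<close> xyz(1) show False by simp
    qed
    then show ?thesis using eq by (rule that)
  next
    case 2
    \<comment> \<open>Multiplying by x^2 + m keeps the left side of the form Z^2 + m Y^2, by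
      multiplicativity of this norm form, and makes the right side n times a square.\<close>
    then have "z\<^sup>2 + int m * y\<^sup>2 = int n * (x\<^sup>2 + int m)"
      using k by (simp add: Q_def algebra_simps)
    moreover have "(z * x + int m * y)\<^sup>2 + int m * (y * x - z)\<^sup>2 = (z\<^sup>2 + int m * y\<^sup>2) * (x\<^sup>2 + int m)"
      by (simp add: power2_eq_square algebra_simps)
    ultimately have "int n * (x\<^sup>2 + int m)\<^sup>2 = (z * x + int m * y)\<^sup>2 + int m * (y * x - z)\<^sup>2"
      by (simp add: power2_eq_square)
    moreover have "x\<^sup>2 + int m \<noteq> 0" using pos zero_le_power2[of x] by linarith
    ultimately show ?thesis using that by blast
  qed
qed

text \<open>Scaling n x^2 = z^2 + m y^2 by w^2 turns the last term into two squares, which gives n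
  as a sum of three rational squares.\<close>

lemma sum_three_squares_of_auxiliary:
  fixes m n :: nat and \<alpha> \<beta> w u v :: int
  assumes pos: "m > 0" "n > 0" and cop: "coprime m n" and nonsquare: "\<And>k. k\<^sup>2 \<noteq> m * n"
    and \<alpha>: "[\<alpha>\<^sup>2 = int n] (mod int m)" and \<beta>: "[\<beta>\<^sup>2 = - int m] (mod int n)"
    and w: "w \<noteq> 0" "int m * w\<^sup>2 = u\<^sup>2 + v\<^sup>2"
  shows "\<exists>x y z :: int. int n = x\<^sup>2 + y\<^sup>2 + z\<^sup>2"
proof -
  obtain x y z where "x \<noteq> 0" "int n * x\<^sup>2 = z\<^sup>2 + int m * y\<^sup>2"
    by (rule legendre_equation_solvable[OF pos cop nonsquare \<alpha> \<beta>])
  moreover have "int n * \<bar>x * w\<bar>\<^sup>2 = (int n * x\<^sup>2) * w\<^sup>2"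
    by (simp add: power_mult_distrib)
  moreover have "(z\<^sup>2 + int m * y\<^sup>2) * w\<^sup>2 = (z * w)\<^sup>2 + (int m * w\<^sup>2) * y\<^sup>2"
    by (simp add: power_mult_distrib algebra_simps)
  ultimately have "int n * \<bar>x * w\<bar>\<^sup>2 = (z * w)\<^sup>2 + (u * y)\<^sup>2 + (v * y)\<^sup>2"
    unfolding w(2) by (simp add: power_mult_distrib algebra_simps)
  moreover have "\<bar>x * w\<bar> > 0" using \<open>x \<noteq> 0\<close> w(1) by simp
  ultimately show ?thesis by (intro three_rational_squares_descent)
qed

section \<open>Values of the Legendre symbol\<close>

lemma Legendre_cases:
  "Legendre a p = 0 \<or> Legendre a p = 1 \<or> Legendre a p = -1"
  by (simp add: Legendre_def)

lemma Legendre_eq_0_iff: "Legendre a p = 0 \<longleftrightarrow> p dvd a"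
  by (simp add: Legendre_def cong_0_iff)

lemma Legendre_cong: "[a = b] (mod p) \<Longrightarrow> Legendre a p = Legendre b p"
proof -
  assume ab: "[a = b] (mod p)"
  have "[a = 0] (mod p) \<longleftrightarrow> [b = 0] (mod p)"
    using cong_trans[OF ab, of 0] cong_trans[OF cong_sym[OF ab], of 0] by blast
  moreover have "[y\<^sup>2 = a] (mod p) \<longleftrightarrow> [y\<^sup>2 = b] (mod p)" for y
    using cong_trans[OF _ ab, of "y\<^sup>2"] cong_trans[OF _ cong_sym[OF ab], of "y\<^sup>2"] by blast
  ultimately show ?thesis by (simp add: Legendre_def QuadRes_def)
qed

lemma Legendre_eq_1D: "Legendre a p = 1 \<Longrightarrow> \<exists>y. [y\<^sup>2 = a] (mod p)"
  by (auto simp: Legendre_def QuadRes_def split: if_splits)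

text \<open>Euler's criterion gives the identity modulo p; both sides lie between -1 and 1 and p >
  2, so the congruence is an equality.\<close>

lemma Legendre_mult:
  assumes "prime p" "2 < p"
  shows "Legendre (a * b) (int p) = Legendre a (int p) * Legendre b (int p)"
proof -
  let ?k = "(p - 1) div 2"
  have "[Legendre (a * b) (int p) = (a * b) ^ ?k] (mod int p)"
    by (rule euler_criterion[OF assms])
  also have "(a * b) ^ ?k = a ^ ?k * b ^ ?k" by (rule power_mult_distrib)
  also have "[a ^ ?k * b ^ ?k = Legendre a (int p) * Legendre b (int p)] (mod int p)"
    by (intro cong_mult cong_sym[OF euler_criterion[OF assms]])
  finally have *: "int p dvd Legendre (a * b) (int p) - Legendre a (int p) * Legendre b (int p)"
    by (simp add: cong_iff_dvd_diff)
  have "\<bar>Legendre (a * b) (int p) - Legendre a (int p) * Legendre b (int p)\<bar> \<le> 2"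
    using Legendre_cases[of "a * b" "int p"] Legendre_cases[of a "int p"] Legendre_cases[of b "int p"]
    by auto
  then have "\<not> \<bar>int p\<bar> \<le> \<bar>Legendre (a * b) (int p) - Legendre a (int p) * Legendre b (int p)\<bar>"
    using assms(2) by simp
  then show ?thesis using dvd_imp_le_int[OF _ *] by fastforce
qed

lemma Legendre_1:
  assumes "prime p"
  shows "Legendre 1 (int p) = 1"
proof -
  have "\<not> int p dvd 1" using prime_gt_1_nat[OF assms] by auto
  moreover have "QuadRes (int p) 1" unfolding QuadRes_def by (rule exI[of _ 1]) simp
  ultimately show ?thesis by (simp add: Legendre_def cong_0_iff)
qed

lemma eq_of_cong_signs:
  fixes a b :: int
  assumes "2 < p" "[a = b] (mod int p)" "a = 1 \<or> a = -1 \<or> a = 0" "b = 1 \<or> b = -1"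
  shows "a = b"
proof -
  have "int p dvd a - b" using assms(2) by (simp add: cong_iff_dvd_diff)
  moreover have "\<bar>a - b\<bar> < int p" using assms(1,3,4) by auto
  ultimately show ?thesis using dvd_imp_le_int[of "a - b" "int p"] by fastforce
qed

lemma Legendre_minus_1:
  assumes "prime p" "2 < p"
  shows "Legendre (-1) (int p) = (if p mod 4 = 1 then 1 else -1)"
proof -
  have odd: "odd p" using assms prime_odd_nat by blast
  have "Legendre (-1) (int p) = (-1) ^ ((p - 1) div 2)"
    by (rule eq_of_cong_signs[OF assms(2) euler_criterion[OF assms]])
       (use Legendre_cases in \<open>auto simp: minus_one_power_iff\<close>)
  moreover have "even ((p - 1) div 2) \<longleftrightarrow> p mod 4 = 1" using odd by presburger
  ultimately show ?thesis by (simp add: minus_one_power_iff)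
qed

text \<open>Gauss's lemma: with h = (p - 1) / 2, the doubles 2 x of 1, ..., h are already reduced
  modulo p, and those exceeding h come from h div 2 < x <= h. The parity of their number depends on
  p mod 8.\<close>

lemma Legendre_2:
  assumes "prime p" "2 < p"
  shows "Legendre 2 (int p) = (if p mod 8 = 1 \<or> p mod 8 = 7 then 1 else -1)"
proof -
  have odd: "odd p" using assms prime_odd_nat by blast
  interpret GAUSS p 2
  proof
    show "[(2::int) \<noteq> 0] (mod int p)"
      using assms(2) by (simp add: cong_0_iff zdvd_not_zless)
  qed (use assms in auto)
  define h where "h = (int p - 1) div 2"
  have "C = (\<lambda>x. 2 * x) ` {0<..h}"
    unfolding C_def B_def A_def image_image
    by (intro image_cong) (use odd in \<open>auto simp: h_def\<close>)
  then have "E = (\<lambda>x. 2 * x) ` {h div 2<..h}"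
    unfolding E_def h_def[symmetric] using assms(2) by (auto simp: h_def)
  then have "card E = card {h div 2<..h}"
    by (simp add: card_image inj_on_def)
  then have "card E = nat (h - h div 2)" by simp
  moreover have "even (nat (h - h div 2)) \<longleftrightarrow> p mod 8 = 1 \<or> p mod 8 = 7"
  proof -
    have "h = int ((p - 1) div 2)" using assms(2) by (simp add: h_def zdiv_int of_nat_diff)
    then have "nat (h - h div 2) = (p - 1) div 2 - (p - 1) div 2 div 2"
      by (simp add: nat_diff_distrib nat_div_distrib)
    moreover have "even ((p - 1) div 2 - (p - 1) div 2 div 2) \<longleftrightarrow> p mod 8 = 1 \<or> p mod 8 = 7"
    proof -
      define k where "k = p div 8"
      have "p = 8 * k + p mod 8" by (simp add: k_def)
      moreover have "p mod 8 = 1 \<or> p mod 8 = 3 \<or> p mod 8 = 5 \<or> p mod 8 = 7"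
        using odd by presburger
      ultimately consider "p = 8 * k + 1" | "p = 8 * k + 3" | "p = 8 * k + 5" | "p = 8 * k + 7"
        by metis
      then show ?thesis
      proof cases
        case 1
        then have "(p - 1) div 2 = 4 * k" "4 * k div 2 = 2 * k" by simp_all
        then show ?thesis using 1 by (simp add: mod_mult_self4)
      next
        case 2
        then have "(p - 1) div 2 = 4 * k + 1" "(4 * k + 1) div 2 = 2 * k" by simp_all
        then show ?thesis using 2 by simp
      next
        case 3
        then have "(p - 1) div 2 = 4 * k + 2" "(4 * k + 2) div 2 = 2 * k + 1" by simp_all
        then show ?thesis using 3 by simp
      next
        case 4
        then have "(p - 1) div 2 = 4 * k + 3" "(4 * k + 3) div 2 = 2 * k + 1" by simp_all
        then have "(p - 1) div 2 - (p - 1) div 2 div 2 = 2 * (k + 1)" by simp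
        moreover have "p mod 8 = 7" using 4 by simp
        ultimately show ?thesis by simp
      qed
    qed
    ultimately show ?thesis by simp
  qed
  ultimately show ?thesis
    by (simp add: gauss_lemma minus_one_power_iff)
qed

subsection \<open>Sums of three squares\<close>

text \<open>The principal factor sets the function to 0 off the units, so a sign function only has
  to be multiplicative on units.\<close>

lemma real_char_of_multiplicative:
  assumes "M > 0"
    and mult: "\<And>a b. coprime a M \<Longrightarrow> coprime b M \<Longrightarrow> g (a * b) = g a * g b"
    and per: "\<And>k. g (k mod M) = g k"
    and val: "\<And>k. coprime k M \<Longrightarrow> g k = 1 \<or> g k = -1"
  shows "real_char M (\<lambda>k. principal_char M k * g k)"
proof
  fix a b
  show "principal_char M (a * b) * g (a * b) = principal_char M a * g a * (principal_char M b * g b)"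
    by (simp add: principal_char_def mult)
next
  fix k
  show "principal_char M (k mod M) * g (k mod M) = principal_char M k * g k"
    using assms(1) by (simp add: principal_char_def per)
next
  fix k assume "coprime k M"
  then show "principal_char M k * g k = 1 \<or> principal_char M k * g k = - 1"
    using val[of k] by (simp add: principal_char_def)
qed (use assms(1) in \<open>simp_all add: principal_char_def\<close>)

text \<open>The Chinese remainder theorem gives an integer d with the wanted properties. The residue
  modulo 8 and the symbols at the primes dividing N are visible to real characters modulo 8 N, so a
  prime with the same real characters as d inherits them.\<close>

lemma exists_prime_with_symbols:
  fixes N r :: nat and c :: int
  assumes "odd N" and r: "r = 1 \<or> r = 5" and c: "coprime c (int N)"
  obtains q where "prime q" "q mod 8 = r" "coprime q N"
    "\<And>l. prime l \<Longrightarrow> l dvd N \<Longrightarrow> Legendre (int q) (int l) = Legendre c (int l)"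
proof -
  define M where "M = 8 * N"
  have N: "N > 0" using assms(1) by (intro Nat.gr0I) auto
  then have M: "M > 0" by (simp add: M_def)
  have "coprime (2 ^ 3) N"
    using assms(1) by (simp only: coprime_power_left_iff coprime_left_2_iff_odd) simp
  then have "coprime 8 N" by simp
  then obtain d where d: "[d = r] (mod 8)" "[d = nat (c mod int N)] (mod N)"
    using binary_chinese_remainder_nat by blast
  have dc: "[int d = c] (mod int N)"
  proof -
    have "[int d = c mod int N] (mod int N)"
      using d(2) N by (simp flip: cong_int_iff)
    then show ?thesis by (simp add: cong_def)
  qed
  have d8: "d mod 8 = r" using d(1) r by (auto simp: cong_def)
  then have "odd d" using r by presburger
  then have "coprime (2 ^ 3) d"
    by (simp only: coprime_power_left_iff coprime_left_2_iff_odd) simp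
  then have "coprime d 8" by (simp add: coprime_commute)
  moreover have "coprime d N"
    using c cong_imp_coprime[OF cong_sym[OF dc]] by simp
  ultimately have "coprime d M" by (simp add: M_def)
  then obtain q where q: "prime q" "coprime q M" "\<And>chi. real_char M chi \<Longrightarrow> chi q = chi d"
    using exists_prime_same_real_chars[OF M] by blast
  have transfer: "g q = g d"
    if "\<And>a b. coprime a M \<Longrightarrow> coprime b M \<Longrightarrow> g (a * b) = g a * g b"
       "\<And>k. g (k mod M) = g k" "\<And>k. coprime k M \<Longrightarrow> g k = 1 \<or> g k = -1" for g :: "nat \<Rightarrow> real"
    using q(3)[OF real_char_of_multiplicative[OF M that]] q(2) \<open>coprime d M\<close>
    by (simp add: principal_char_def)
  have odd: "odd k" if "coprime k M" for k
    using coprime_common_divisor[OF that, of 2] by (auto simp: M_def)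
  have mod8: "k mod 8 = 1 \<or> k mod 8 = 3 \<or> k mod 8 = 5 \<or> k mod 8 = 7" if "coprime k M" for k
    using odd[OF that] by presburger
  have mod_M: "k mod M mod 8 = k mod 8" "k mod M mod N = k mod N" for k
    by (simp_all add: M_def mod_mod_cancel)
  \<comment> \<open>On odd k these are the symbols (-1/k) and (2/k); together they determine k mod
    8.\<close>
  define f where "f k = (if k mod 8 = 1 \<or> k mod 8 = 5 then 1 else - 1 :: real)" for k :: nat
  define g where "g k = (if k mod 8 = 1 \<or> k mod 8 = 7 then 1 else - 1 :: real)" for k :: nat
  have mult8: "(a * b) mod 8 = (a mod 8) * (b mod 8) mod 8" for a b :: nat
    by (simp add: mod_mult_eq)
  have "f q = f d"
  proof (rule transfer)
    fix a b assume "coprime a M" "coprime b M"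
    from mod8[OF this(1)] mod8[OF this(2)] show "f (a * b) = f a * f b"
      unfolding f_def mult8[of a b] by (elim disjE) simp_all
  qed (simp_all add: f_def mod_M)
  moreover have "g q = g d"
  proof (rule transfer)
    fix a b assume "coprime a M" "coprime b M"
    from mod8[OF this(1)] mod8[OF this(2)] show "g (a * b) = g a * g b"
      unfolding g_def mult8[of a b] by (elim disjE) simp_all
  qed (simp_all add: g_def mod_M)
  ultimately have "q mod 8 = r"
    using mod8[OF q(2)] r d8 by (auto simp: f_def g_def split: if_splits)
  moreover have "Legendre (int q) (int l) = Legendre c (int l)" if l: "prime l" "l dvd N" for l
  proof -
    have "l \<noteq> 2" using l(2) assms(1) by auto
    then have "2 < l" using prime_ge_2_nat[OF l(1)] by simp
    have ndvd: "\<not> int l dvd int k" if "coprime k M" for k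
      using coprime_common_divisor[OF that, of l] l \<open>2 < l\<close> by (auto simp: M_def)
    have "real_of_int (Legendre (int q) (int l)) = real_of_int (Legendre (int d) (int l))"
    proof (rule transfer)
      fix k
      have "[int (k mod M) = int k] (mod int l)"
        unfolding cong_int_iff using l(2) by (simp add: cong_def M_def mod_mod_cancel)
      then show "real_of_int (Legendre (int (k mod M)) (int l)) = real_of_int (Legendre (int k) (int l))"
        by (simp add: Legendre_cong)
    next
      fix k assume "coprime k M"
      then show "real_of_int (Legendre (int k) (int l)) = 1 \<or> real_of_int (Legendre (int k) (int l)) = - 1"
        using ndvd[of k] Legendre_cases[of "int k" "int l"] Legendre_eq_0_iff[of "int k" "int l"] by auto
    qed (simp add: Legendre_mult[OF l(1) \<open>2 < l\<close>])
    moreover have "Legendre (int d) (int l) = Legendre c (int l)"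
      by (rule Legendre_cong[OF cong_dvd_modulus[OF dc]]) (use l in simp)
    ultimately show ?thesis by simp
  qed
  moreover have "coprime q N" using q(2) by (simp add: M_def)
  ultimately show ?thesis using q(1) that by blast
qed

text \<open>Square roots modulo the prime factors are glued by the Chinese remainder theorem;
  squarefreeness makes each prime coprime to its cofactor.\<close>

lemma quadratic_residue_mod_squarefree:
  fixes N :: nat and a :: int
  assumes "squarefree N" "\<And>l. prime l \<Longrightarrow> l dvd N \<Longrightarrow> \<exists>y. [y\<^sup>2 = a] (mod int l)"
  shows "\<exists>y. [y\<^sup>2 = a] (mod int N)"
  using assms
proof (induction N rule: less_induct)
  case (less N)
  show ?case
  proof (cases "N = 1")
    case False
    then obtain l where l: "prime l" "l dvd N" using prime_factor_nat by blast
    then obtain N' where N': "N = l * N'" by blast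
    have "N > 0" using less.prems(1) by (intro Nat.gr0I) simp
    then have "N' < N" using N' prime_gt_1_nat[OF l(1)] by simp
    have "\<not> l dvd N'"
    proof
      assume "l dvd N'"
      then have "l\<^sup>2 dvd N" by (simp add: N' power2_eq_square)
      then have "is_unit l" using less.prems(1) squarefreeD by blast
      then show False using l(1) by auto
    qed
    then have cop: "coprime (int l) (int N')" using l(1) by (simp add: prime_imp_coprime)
    obtain y where y: "[y\<^sup>2 = a] (mod int l)" using less.prems(2) l by blast
    have "squarefree N'" using less.prems(1) squarefree_mono[of N' N] N' by simp
    then obtain y' where y': "[y'\<^sup>2 = a] (mod int N')"
      using less.IH[OF \<open>N' < N\<close>] less.prems(2) N' by auto
    obtain x where x: "[x = y] (mod int l)" "[x = y'] (mod int N')"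
      using binary_chinese_remainder_int[OF cop] by blast
    have "[x\<^sup>2 = a] (mod int l)" "[x\<^sup>2 = a] (mod int N')"
      using cong_trans[OF cong_pow[OF x(1)] y] cong_trans[OF cong_pow[OF x(2)] y'] by auto
    then have "[x\<^sup>2 = a] (mod int l * int N')"
      using cop by (rule coprime_cong_mult)
    then show ?thesis using N' by auto
  qed simp
qed

text \<open>Evaluates the symbol of N from its values at the prime factors; \<open>g\<close> stands
  for a sign given by residue classes, multiplicative on odd numbers.\<close>

lemma Legendre_multiplicative_extension:
  fixes N q :: nat and g :: "nat \<Rightarrow> int"
  assumes q: "prime q" "2 < q" and g1: "g 1 = 1"
    and g: "\<And>a b. odd a \<Longrightarrow> odd b \<Longrightarrow> g (a * b) = g a * g b"
    and "odd N" "\<And>l. prime l \<Longrightarrow> l dvd N \<Longrightarrow> Legendre (int l) (int q) = g l"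
  shows "Legendre (int N) (int q) = g N"
  using assms(5,6)
proof (induction N rule: less_induct)
  case (less N)
  show ?case
  proof (cases "N = 1")
    case True
    then show ?thesis using g1 Legendre_1[OF q(1)] by simp
  next
    case False
    then obtain l where l: "prime l" "l dvd N" using prime_factor_nat by blast
    then obtain N' where N': "N = l * N'" by blast
    have "N > 0" using less.prems(1) by (intro Nat.gr0I) simp
    then have "N' < N" using N' prime_gt_1_nat[OF l(1)] by simp
    have odd: "odd l" "odd N'" using less.prems(1) N' by auto
    have "Legendre (int N') (int q) = g N'"
      using less.IH[OF \<open>N' < N\<close> odd(2)] less.prems(2) N' by auto
    then show ?thesis
      using less.prems(2)[OF l] g[OF odd] by (simp add: N' Legendre_mult[OF q])
  qed
qed

lemma Legendre_reciprocity_1_mod_4: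
  assumes "prime q" "q mod 4 = 1" "prime l" "odd l" "l \<noteq> q"
  shows "Legendre (int l) (int q) = Legendre (int q) (int l)"
proof -
  have "2 < q" using assms(2) prime_ge_2_nat[OF assms(1)] by (cases "q = 2") auto
  have "2 < l" using assms(4) prime_ge_2_nat[OF assms(3)] by (cases "l = 2") auto
  have "even ((q - 1) div 2)" using assms(2) by presburger
  then have "Legendre (int l) (int q) * Legendre (int q) (int l) = 1"
    using Quadratic_Reciprocity[OF assms(3) \<open>2 < l\<close> assms(1) \<open>2 < q\<close> assms(5)]
    by (simp add: minus_one_power_iff)
  then show ?thesis
    using Legendre_cases[of "int l" "int q"] Legendre_cases[of "int q" "int l"] by auto
qed

text \<open>The Legendre equation with m = 1 and n = q: -1 is a square modulo q, and the condition
  modulo 1 is void, so \<alpha> = 0 serves.\<close>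

lemma prime_1_mod_4_rational_two_squares:
  assumes q: "prime q" "q mod 4 = 1"
  obtains w u v :: int where "w \<noteq> 0" "int q * w\<^sup>2 = u\<^sup>2 + v\<^sup>2"
proof -
  have "2 < q" using q(2) prime_ge_2_nat[OF q(1)] by (cases "q = 2") auto
  then have "Legendre (-1) (int q) = 1" using Legendre_minus_1[OF q(1)] q(2) by simp
  then obtain \<beta> where \<beta>: "[\<beta>\<^sup>2 = - int 1] (mod int q)" using Legendre_eq_1D by force
  have nonsq: "k\<^sup>2 \<noteq> 1 * q" for k
  proof
    assume "k\<^sup>2 = 1 * q"
    then have "k * k = q" by (simp add: power2_eq_square)
    then have "k = 1 \<or> k = q" using q(1) prime_product[of k k] by auto
    then show False using \<open>k * k = q\<close> \<open>2 < q\<close> by auto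
  qed
  show ?thesis
    by (rule legendre_equation_solvable[of 1 q 0 \<beta>])
       (use q(1) \<beta> nonsq that prime_gt_0_nat in \<open>auto simp: cong_def\<close>)
qed

text \<open>Assembles the local conditions at single primes into the two square roots needed for m =
  e q.\<close>

lemma three_squares_of_prime:
  fixes n q e :: nat
  assumes n: "squarefree n" and q: "prime q" "q mod 4 = 1" and e: "e = 1 \<or> e = 2"
    and cop: "coprime (e * q) n" and L: "Legendre (int n) (int q) = 1"
    and Ln: "\<And>l. prime l \<Longrightarrow> odd l \<Longrightarrow> l dvd n \<Longrightarrow> Legendre (- int (e * q)) (int l) = 1"
  shows "\<exists>x y z :: int. int n = x\<^sup>2 + y\<^sup>2 + z\<^sup>2"
proof -
  have "n > 0" using n by (intro Nat.gr0I) simp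
  have "2 < q" using q(2) prime_ge_2_nat[OF q(1)] by (cases "q = 2") auto
  have mod2: "\<exists>y. [y\<^sup>2 = a] (mod int 2)" for a
    by (rule exI[of _ a]) (simp add: cong_def mod_eq_dvd_iff power2_eq_square mod_mult_eq flip: even_iff_mod_2_eq_zero)
  have "squarefree (e * q)"
  proof -
    have "coprime 2 q" using \<open>2 < q\<close> q(1) prime_odd_nat by (simp add: coprime_left_2_iff_odd)
    then show ?thesis using e q(1) squarefree_mult_coprime[OF _ squarefree_prime squarefree_prime, of 2 q] squarefree_prime[of q] by auto
  qed
  then have "\<exists>\<alpha>. [\<alpha>\<^sup>2 = int n] (mod int (e * q))"
  proof (rule quadratic_residue_mod_squarefree)
    fix l assume l: "prime l" "l dvd e * q"
    then have "l = 2 \<or> l = q"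
      using e q(1) by (metis mult_1 prime_dvd_mult_iff primes_dvd_imp_eq two_is_prime_nat)
    then show "\<exists>y. [y\<^sup>2 = int n] (mod int l)"
      using mod2 Legendre_eq_1D[OF L] by auto
  qed
  then obtain \<alpha> where \<alpha>: "[\<alpha>\<^sup>2 = int n] (mod int (e * q))" by blast
  have "\<exists>\<beta>. [\<beta>\<^sup>2 = - int (e * q)] (mod int n)"
  proof (rule quadratic_residue_mod_squarefree[OF n])
    fix l assume l: "prime l" "l dvd n"
    show "\<exists>y. [y\<^sup>2 = - int (e * q)] (mod int l)"
    proof (cases "odd l")
      case True
      then show ?thesis using Legendre_eq_1D[OF Ln[OF l(1) True l(2)]] by simp
    next
      case False
      then have "l = 2" using l(1) by (metis prime_odd_nat prime_ge_2_nat le_neq_implies_less)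
      then show ?thesis using mod2 by simp
    qed
  qed
  then obtain \<beta> where \<beta>: "[\<beta>\<^sup>2 = - int (e * q)] (mod int n)" by blast
  \<comment> \<open>The prime q divides e q n exactly once.\<close>
  have nonsq: "k\<^sup>2 \<noteq> e * q * n" for k
  proof
    assume k: "k\<^sup>2 = e * q * n"
    then have "q dvd k\<^sup>2" by simp
    then have "q dvd k" using q(1) prime_dvd_power by blast
    then have "q * q dvd e * q * n" unfolding k[symmetric] power2_eq_square by (intro mult_dvd_mono \<open>q dvd k\<close>)
    then have "q * q dvd q * (e * n)" by (simp add: mult_ac)
    then have "q dvd e * n" using q(1) by (simp add: prime_gt_0_nat)
    moreover have "\<not> q dvd n" using cop q(1) by (metis coprime_common_divisor dvd_triv_right not_prime_unit)
    moreover have "\<not> q dvd e" using e \<open>2 < q\<close> by (auto dest: dvd_imp_le)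
    ultimately show False using q(1) by (simp add: prime_dvd_mult_iff)
  qed
  obtain w u v :: int where w: "w \<noteq> 0" "int q * w\<^sup>2 = u\<^sup>2 + v\<^sup>2"
    by (rule prime_1_mod_4_rational_two_squares[OF q])
  have "\<exists>u v. int (e * q) * w\<^sup>2 = u\<^sup>2 + v\<^sup>2"
  proof (cases "e = 1")
    case True
    then show ?thesis using w(2) by auto
  next
    case False
    \<comment> \<open>Here e = 2, and doubling a sum of two squares gives a sum of two
      squares.\<close>
    then have "int (e * q) * w\<^sup>2 = (u + v)\<^sup>2 + (u - v)\<^sup>2"
      using e w(2) by (simp add: power2_eq_square algebra_simps)
    then show ?thesis by blast
  qed
  then obtain u' v' where "int (e * q) * w\<^sup>2 = u'\<^sup>2 + v'\<^sup>2" by blast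
  then show ?thesis
    using e \<open>2 < q\<close> \<open>n > 0\<close>
    by (intro sum_three_squares_of_auxiliary[OF _ _ cop nonsq \<alpha> \<beta> w(1)]) auto
qed

text \<open>Choosing (q/l) = (-e/l) for all primes l dividing N makes -e q a square modulo each l.
  As q = 1 mod 4, reciprocity turns (N/q) into the product of the (-e/l), which is g(N); the
  congruence class of n and the choice of q mod 8 then give (n/q) = 1.\<close>

lemma three_squares_squarefree:
  fixes n :: nat
  assumes n: "squarefree n" and cases: "n mod 4 = 1 \<or> n mod 4 = 2 \<or> n mod 8 = 3"
  shows "\<exists>x y z :: int. int n = x\<^sup>2 + y\<^sup>2 + z\<^sup>2"
proof -
  define e N :: nat where "e = (if n mod 8 = 3 then 2 else 1)" and "N = (if even n then n div 2 else n)"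
  \<comment> \<open>For even n the extra factor (2/q) has to cancel g(N): it is -1 for q = 5 mod 8,
    as needed when N = 3 mod 4.\<close>
  define r :: nat where "r = (if even n \<and> N mod 4 = 3 then 5 else 1)"
  \<comment> \<open>On odd k this is the Jacobi symbol (-e/k).\<close>
  define g :: "nat \<Rightarrow> int" where
    "g k = (if e = 1 then if k mod 4 = 1 then 1 else -1 else if k mod 8 = 1 \<or> k mod 8 = 3 then 1 else -1)" for k
  have nN: "n = (if even n then 2 * N else N)" by (simp add: N_def)
  have "odd N" using cases unfolding N_def by presburger
  have e: "e = 1 \<or> e = 2" by (simp add: e_def)
  have e2: "even n \<Longrightarrow> e = 1" unfolding e_def by presburger
  have r: "r = 1 \<or> r = 5" by (simp add: r_def)
  have "coprime (- int e) (int N)" using e \<open>odd N\<close> by (auto simp: coprime_left_2_iff_odd)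
  then obtain q where q: "prime q" "q mod 8 = r" "coprime q N"
    and symb: "\<And>l. prime l \<Longrightarrow> l dvd N \<Longrightarrow> Legendre (int q) (int l) = Legendre (- int e) (int l)"
    using exists_prime_with_symbols[OF \<open>odd N\<close> r] by blast
  have "q mod 8 = 1 \<or> q mod 8 = 5" using q(2) r by auto
  then have q4: "q mod 4 = 1" by presburger
  then have "2 < q" using prime_ge_2_nat[OF q(1)] by (cases "q = 2") auto
  have g_eq: "Legendre (- int e) (int l) = g l" if "prime l" "2 < l" for l
  proof -
    have "odd l" using that prime_odd_nat by blast
    then have residues: "l mod 8 = 1 \<or> l mod 8 = 3 \<or> l mod 8 = 5 \<or> l mod 8 = 7" by presburger
    have mod4: "l mod 4 = 1 \<longleftrightarrow> l mod 8 = 1 \<or> l mod 8 = 5" by presburger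
    show ?thesis
    proof (cases "e = 1")
      case True
      then show ?thesis by (simp add: g_def Legendre_minus_1[OF that])
    next
      case False
      then have "Legendre (- int e) (int l) = Legendre (-1) (int l) * Legendre 2 (int l)"
        using e Legendre_mult[OF that, of "-1" 2] by simp
      then show ?thesis
        using residues False unfolding g_def Legendre_minus_1[OF that] Legendre_2[OF that] mod4
        by (elim disjE) simp_all
    qed
  qed
  have l_gt: "2 < l" if "prime l" "l dvd N" for l
    using that \<open>odd N\<close> prime_ge_2_nat[of l] by (cases "l = 2") auto
  have "Legendre (int N) (int q) = g N"
  proof (rule Legendre_multiplicative_extension[OF q(1) \<open>2 < q\<close> _ _ \<open>odd N\<close>])
    show "g 1 = 1" by (simp add: g_def)
    show "g (a * b) = g a * g b" if "odd a" "odd b" for a b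
    proof -
      have residues: "a mod 8 = 1 \<or> a mod 8 = 3 \<or> a mod 8 = 5 \<or> a mod 8 = 7"
        "b mod 8 = 1 \<or> b mod 8 = 3 \<or> b mod 8 = 5 \<or> b mod 8 = 7"
        using that by presburger+
      have g8: "g k = g (k mod 8)" for k by (simp add: g_def mod_mod_cancel)
      have "g (a * b) = g (a mod 8 * (b mod 8) mod 8)"
        using g8[of "a * b"] by (simp only: mod_mult_eq)
      then have eqs: "g (a * b) = g (a mod 8 * (b mod 8) mod 8)" "g a = g (a mod 8)" "g b = g (b mod 8)"
        using g8 by blast+
      show ?thesis
        unfolding eqs using residues by (elim disjE) (simp_all add: g_def)
    qed
    fix l assume l: "prime l" "l dvd N"
    have "odd l" using l_gt[OF l] l(1) prime_odd_nat by blast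
    moreover have "l \<noteq> q" using q(1,3) l(2) by (metis coprime_common_divisor dvd_refl not_prime_unit)
    ultimately show "Legendre (int l) (int q) = g l"
      using Legendre_reciprocity_1_mod_4[OF q(1) q4 l(1)] symb[OF l] g_eq[OF l(1) l_gt[OF l]] by simp
  qed
  then have LN: "Legendre (int N) (int q) = g N" .
  have "Legendre (int n) (int q) = 1"
  proof (cases "even n")
    case True
    then have "Legendre (int n) (int q) = Legendre 2 (int q) * g N"
      using Legendre_mult[OF q(1) \<open>2 < q\<close>, of 2 "int N"] nN LN by simp
    moreover have "Legendre 2 (int q) = (if r = 1 then 1 else -1)"
      using Legendre_2[OF q(1) \<open>2 < q\<close>] q(2) r by auto
    moreover have "N mod 4 = 1 \<or> N mod 4 = 3" using \<open>odd N\<close> by presburger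
    ultimately show ?thesis using e2[OF True] True by (auto simp: g_def r_def)
  next
    case False
    then have "N = n" using nN by simp
    show ?thesis
    proof (cases "n mod 8 = 3")
      case True
      then show ?thesis using LN by (simp add: \<open>N = n\<close> g_def e_def)
    next
      case mod8: False
      then have "n mod 4 = 1" using cases False by presburger
      then show ?thesis using LN mod8 by (simp add: \<open>N = n\<close> g_def e_def)
    qed
  qed
  moreover have "coprime (e * q) n"
  proof -
    have "odd q" using q4 by presburger
    then have "coprime q 2" by simp
    then have "coprime q n" using nN q(3) by (cases "even n") auto
    moreover have "coprime e n" using e e2 by (cases "even n") (auto simp: coprime_left_2_iff_odd)
    ultimately show ?thesis by simp
  qed
  moreover have "Legendre (- int (e * q)) (int l) = 1" if l: "prime l" "odd l" "l dvd n" for l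
  proof -
    have "coprime l 2" using l(2) by simp
    then have "l dvd N" using l(3) nN by (metis coprime_dvd_mult_right_iff)
    have "Legendre (- int e * int q) (int l) = (Legendre (- int e) (int l))\<^sup>2"
      unfolding Legendre_mult[OF l(1) l_gt[OF l(1) \<open>l dvd N\<close>], of "- int e" "int q"]
        symb[OF l(1) \<open>l dvd N\<close>] power2_eq_square ..
    also have "\<dots> = 1"
      unfolding g_eq[OF l(1) l_gt[OF l(1) \<open>l dvd N\<close>]] by (simp add: g_def)
    finally show ?thesis by simp
  qed
  ultimately show ?thesis
    by (intro three_squares_of_prime[OF n q(1) q4 e]) auto
qed

text \<open>Since 4 does not divide n, the square part k^2 is odd, hence 1 mod 8; so the squarefree
  part has the same residues as n, and its representation is scaled by k.\<close>

theorem three_squares: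
  fixes n :: int
  assumes "n > 0" "n mod 4 = 1 \<or> n mod 4 = 2 \<or> n mod 8 = 3"
  shows "\<exists>x y z. n = x\<^sup>2 + y\<^sup>2 + z\<^sup>2"
proof -
  define k s where "k = square_part (nat n)" and "s = squarefree_part (nat n)"
  have n: "nat n = k\<^sup>2 * s"
    unfolding k_def s_def using squarefree_decompose[of "nat n"] by (simp add: mult.commute)
  have "int (nat n) = n" using assms(1) by simp
  then have nat_mod: "nat n mod 4 = 1 \<or> nat n mod 4 = 2 \<or> nat n mod 8 = 3"
    using assms(2) by (metis of_nat_1 of_nat_eq_iff of_nat_mod of_nat_numeral)
  have "odd k"
  proof
    assume "even k"
    then have "4 dvd nat n" unfolding n by (auto simp: power2_eq_square elim!: evenE)
    then have "nat n mod 4 = 0" "nat n mod 8 mod 4 = 0" by (simp_all add: mod_mod_cancel dvd_eq_mod_eq_0)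
    then show False using nat_mod by auto
  qed
  then have "k mod 8 = 1 \<or> k mod 8 = 3 \<or> k mod 8 = 5 \<or> k mod 8 = 7" by presburger
  then have k8: "k\<^sup>2 mod 8 = 1"
    unfolding power2_eq_square by (subst mod_mult_eq[symmetric]) auto
  then have k4: "k\<^sup>2 mod 4 = 1" by presburger
  have "nat n mod 8 = s mod 8" "nat n mod 4 = s mod 4"
    unfolding n using mod_mult_left_eq[of "k\<^sup>2" 8 s] mod_mult_left_eq[of "k\<^sup>2" 4 s] k8 k4 by simp_all
  moreover have "squarefree s"
    by (simp add: s_def)
  ultimately obtain x y z :: int where "int s = x\<^sup>2 + y\<^sup>2 + z\<^sup>2"
    using three_squares_squarefree[of s] nat_mod by auto
  then have "n = (int k * x)\<^sup>2 + (int k * y)\<^sup>2 + (int k * z)\<^sup>2"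
    using \<open>int (nat n) = n\<close> unfolding n by (simp add: power_mult_distrib algebra_simps)
  then show ?thesis by blast
qed

subsection \<open>Cauchy's lemma and the theorem\<close>

text \<open>The vector (B, X, Y, Z) is sent to (w, x, y, z) by an orthogonal sign matrix of order 4,
  up to scaling. Cauchy-Schwarz gives |X| + |Y| + |Z| < B + 4, so each of 4 w, 4 x, 4 y, 4 z exceeds
  -4 and the integers are nonnegative.\<close>

lemma four_nonnegative_squares_with_sum:
  fixes A B X Y Z :: int
  assumes sq: "4 * A = B\<^sup>2 + X\<^sup>2 + Y\<^sup>2 + Z\<^sup>2" and dvd: "4 dvd B + X + Y + Z"
    and par: "even (X + Y)" "even (X + Z)" "even (Y + Z)"
    and B: "0 \<le> B" "3 * A < B\<^sup>2 + 2 * B + 4"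
  shows "\<exists>w x y z :: nat. A = (int w)\<^sup>2 + (int x)\<^sup>2 + (int y)\<^sup>2 + (int z)\<^sup>2 \<and> B = int w + int x + int y + int z"
proof -
  have "(\<bar>X\<bar> + \<bar>Y\<bar> + \<bar>Z\<bar>)\<^sup>2 \<le> 3 * (X\<^sup>2 + Y\<^sup>2 + Z\<^sup>2)"
  proof -
    have "3 * (X\<^sup>2 + Y\<^sup>2 + Z\<^sup>2) - (\<bar>X\<bar> + \<bar>Y\<bar> + \<bar>Z\<bar>)\<^sup>2
        = (\<bar>X\<bar> - \<bar>Y\<bar>)\<^sup>2 + (\<bar>X\<bar> - \<bar>Z\<bar>)\<^sup>2 + (\<bar>Y\<bar> - \<bar>Z\<bar>)\<^sup>2"
      by (simp add: power2_eq_square algebra_simps)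
    moreover have "0 \<le> (\<bar>X\<bar> - \<bar>Y\<bar>)\<^sup>2 + (\<bar>X\<bar> - \<bar>Z\<bar>)\<^sup>2 + (\<bar>Y\<bar> - \<bar>Z\<bar>)\<^sup>2"
      by (intro add_nonneg_nonneg zero_le_power2)
    ultimately have "0 \<le> 3 * (X\<^sup>2 + Y\<^sup>2 + Z\<^sup>2) - (\<bar>X\<bar> + \<bar>Y\<bar> + \<bar>Z\<bar>)\<^sup>2"
      by (simp only:)
    then show ?thesis by (simp only: diff_ge_0_iff_ge)
  qed
  also have "\<dots> = 3 * (4 * A - B\<^sup>2)" using sq by simp
  \<comment> \<open>The difference of the two sides is 4 (B^2 + 2 B + 4 - 3 A).\<close>
  also have "\<dots> < (B + 4)\<^sup>2" using B(2) by (simp add: power2_eq_square algebra_simps)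
  finally have "\<bar>X\<bar> + \<bar>Y\<bar> + \<bar>Z\<bar> < B + 4"
    by (rule power_less_imp_less_base) (use B(1) in simp)
  obtain w where w: "B + X + Y + Z = 4 * w" using dvd by blast
  obtain p q r where p: "X + Y = 2 * p" and q: "X + Z = 2 * q" and r: "Y + Z = 2 * r"
    using par by (metis evenE)
  define x y z where "x = w - r" and "y = w - q" and "z = w - p"
  have eqs: "4 * w = B + X + Y + Z" "4 * x = B + X - Y - Z" "4 * y = B - X + Y - Z" "4 * z = B - X - Y + Z"
    using w p q r by (simp_all add: x_def y_def z_def)
  then have nonneg: "0 \<le> w" "0 \<le> x" "0 \<le> y" "0 \<le> z"
    using \<open>\<bar>X\<bar> + \<bar>Y\<bar> + \<bar>Z\<bar> < B + 4\<close> by linarith+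
  have sum: "B = w + x + y + z" using eqs by linarith
  have "16 * (w\<^sup>2 + x\<^sup>2 + y\<^sup>2 + z\<^sup>2) = (4 * w)\<^sup>2 + (4 * x)\<^sup>2 + (4 * y)\<^sup>2 + (4 * z)\<^sup>2"
    by (simp add: power_mult_distrib)
  also have "\<dots> = 4 * (B\<^sup>2 + X\<^sup>2 + Y\<^sup>2 + Z\<^sup>2)"
    unfolding eqs by (simp add: power2_eq_square algebra_simps)
  also have "\<dots> = 16 * A" using sq by simp
  finally have "A = w\<^sup>2 + x\<^sup>2 + y\<^sup>2 + z\<^sup>2" by simp
  with sum nonneg show ?thesis
    by (intro exI[of _ "nat w"] exI[of _ "nat x"] exI[of _ "nat y"] exI[of _ "nat z"]) simp
qed

lemma square_mod_4: "u\<^sup>2 mod 4 = (if odd u then 1 else 0 :: int)"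
proof (cases "odd u")
  case True
  then obtain c where "u = 2 * c + 1" by (auto elim: oddE)
  then have "u\<^sup>2 = 4 * (c\<^sup>2 + c) + 1" by (simp add: power2_eq_square algebra_simps)
  then show ?thesis using True by presburger
qed (auto simp: power2_eq_square elim!: evenE)

text \<open>In the odd case 4 A - B^2 is 3 mod 8. In the even case a factor 4 is removed first, and
  A - (B/2)^2 is 1 or 2 mod 4. Both are residues covered by the three-square theorem.\<close>

lemma cauchy_lemma:
  fixes A B :: int
  assumes par: "odd A \<and> odd B \<or> A mod 4 = 2 \<and> even B"
    and B: "0 \<le> B" "B\<^sup>2 \<le> 4 * A" "3 * A < B\<^sup>2 + 2 * B + 4"
  shows "\<exists>w x y z :: nat. A = (int w)\<^sup>2 + (int x)\<^sup>2 + (int y)\<^sup>2 + (int z)\<^sup>2 \<and> B = int w + int x + int y + int z"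
  using par
proof
  assume odd: "odd A \<and> odd B"
  then obtain b where b: "B = 2 * b + 1" by (auto elim: oddE)
  obtain a where a: "A = 2 * a + 1" using odd by (auto elim: oddE)
  have "even (b * (b + 1))" by simp
  then obtain t where t: "b * (b + 1) = 2 * t" by blast
  have eq: "4 * A - B\<^sup>2 = 8 * (a - t) + 3"
    using t unfolding a b by (simp add: power2_eq_square algebra_simps)
  then have mod8: "(4 * A - B\<^sup>2) mod 8 = 3" by presburger
  have "4 * A - B\<^sup>2 > 0" using B(2) eq by presburger
  then obtain X Y Z where XYZ: "4 * A - B\<^sup>2 = X\<^sup>2 + Y\<^sup>2 + Z\<^sup>2"
    using three_squares[of "4 * A - B\<^sup>2"] mod8 by blast
  have "k mod 4 = 3" if "k mod 8 = 3" for k :: int using that by presburger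
  from this[OF mod8[unfolded XYZ]]
  have "((X\<^sup>2 mod 4 + Y\<^sup>2 mod 4) mod 4 + Z\<^sup>2 mod 4) mod 4 = 3"
    by (simp only: mod_add_eq)
  then have odds: "odd X" "odd Y" "odd Z" unfolding square_mod_4 by (auto split: if_splits)
  \<comment> \<open>The sum is even, and flipping the sign of the odd Z changes it by 2 mod
    4.\<close>
  then have "4 dvd B + X + Y + Z \<or> 4 dvd B + X + Y + (- Z)" using odd by presburger
  then show ?thesis
  proof
    assume "4 dvd B + X + Y + Z"
    then show ?thesis
      by (rule four_nonnegative_squares_with_sum[rotated]) (use XYZ odds B in auto)
  next
    assume "4 dvd B + X + Y + (- Z)"
    then show ?thesis
      by (rule four_nonnegative_squares_with_sum[rotated]) (use XYZ odds B in auto)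
  qed
next
  assume even: "A mod 4 = 2 \<and> even B"
  then obtain b where b: "B = 2 * b" by blast
  have "b\<^sup>2 mod 4 = 0 \<or> b\<^sup>2 mod 4 = 1"
    by (simp add: square_mod_4)
  then have mod4: "(A - b\<^sup>2) mod 4 = 1 \<or> (A - b\<^sup>2) mod 4 = 2" using even by presburger
  moreover have "A - b\<^sup>2 \<ge> 0" using B(2) by (simp add: b power2_eq_square)
  ultimately have "A - b\<^sup>2 > 0" by (cases "A - b\<^sup>2 = 0") auto
  then obtain x y z where xyz: "A - b\<^sup>2 = x\<^sup>2 + y\<^sup>2 + z\<^sup>2"
    using three_squares[of "A - b\<^sup>2"] mod4 by blast
  have "even A" using even by presburger
  moreover have "b\<^sup>2 + x\<^sup>2 + y\<^sup>2 + z\<^sup>2 = A" using xyz by simp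
  ultimately have "even (b\<^sup>2 + x\<^sup>2 + y\<^sup>2 + z\<^sup>2)" by simp
  then have "even (b + x + y + z)" by simp
  then have "2 * 2 dvd 2 * (b + x + y + z)" by (rule mult_dvd_mono[OF dvd_refl])
  then have "4 dvd B + 2 * x + 2 * y + 2 * z" by (simp add: b algebra_simps)
  then show ?thesis
    by (rule four_nonnegative_squares_with_sum[rotated])
       (use xyz B in \<open>auto simp: b power_mult_distrib\<close>)
qed

text \<open>With \<open>P = \<surd>(a n + b\<^sup>2)\<close> and \<open>t = (2 P - 2 b - 2 a\<^sup>2) / a\<close>, the length-\<open>2 a\<close>
  window below the positive root of \<open>a x\<^sup>2 + 4 b x = 4 n\<close> starts at \<open>t\<close>; the bound on \<open>n\<close> says exactly that \<open>t\<close> exceeds the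
  positive root of \<open>a x\<^sup>2 + (2 a + 3 b) x + 4 a = 3 n\<close>.\<close>

lemma admissible_window:
  fixes a b n x :: real
  defines "D \<equiv> 2 * a * (2 * a - 1) + b" and "E \<equiv> 2 * a * (a - 1) + b"
  assumes a: "1 \<le> a" and b: "- a < b" and E: "0 \<le> E"
    and n: "n > 4 * a * (7 * a * (a - 1) + 1) + 2 * (7 * a - 2) * b + 2 * D * sqrt (6 * E)"
    and lo: "2 * sqrt (a * n + b\<^sup>2) - 2 * b - 2 * a\<^sup>2 < a * x"
    and hi: "a * x \<le> 2 * sqrt (a * n + b\<^sup>2) - 2 * b"
  shows "0 < x" "a * x\<^sup>2 + 4 * b * x \<le> 4 * n" "3 * n < a * x\<^sup>2 + (2 * a + 3 * b) * x + 4 * a"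
proof -
  define S where "S = sqrt (6 * E)"
  define P where "P = sqrt (a * n + b\<^sup>2)"
  have S: "0 \<le> S" "S\<^sup>2 = 6 * E" using E by (simp_all add: S_def)
  have aa: "a \<le> a * a" using a by simp
  have "D = 4 * (a * a) - 2 * a + b" unfolding D_def by (simp add: algebra_simps)
  then have D: "0 < D" using a b aa by linarith
  \<comment> \<open>The bound on n, multiplied by a and increased by b^2, is exactly this square; so
    it says D + a S < P.\<close>
  have "(D + a * S)\<^sup>2 = D\<^sup>2 + 2 * a * D * S + a\<^sup>2 * (6 * E)"
    using S(2) by (simp add: power2_eq_square algebra_simps)
  also have "\<dots> = a * (4 * a * (7 * a * (a - 1) + 1) + 2 * (7 * a - 2) * b + 2 * D * S) + b\<^sup>2"
    unfolding D_def E_def by (simp add: power2_eq_square algebra_simps)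
  also have "\<dots> < a * n + b\<^sup>2"
    using n a by (simp add: S_def mult_strict_left_mono)
  finally have less: "(D + a * S)\<^sup>2 < a * n + b\<^sup>2" .
  then have P2: "P\<^sup>2 = a * n + b\<^sup>2" unfolding P_def
    by (intro real_sqrt_pow2 less_imp_le[OF le_less_trans[OF zero_le_power2 less]])
  have "0 \<le> P" unfolding P_def by (rule real_sqrt_ge_zero, rule less_imp_le[OF le_less_trans[OF zero_le_power2 less]])
  have P: "D + a * S < P"
    using less \<open>0 \<le> P\<close> unfolding P2[symmetric] by (rule power_less_imp_less_base)
  \<comment> \<open>This is a t; working with a x in place of x clears the denominator of t.\<close>
  define u where "u = 2 * P - 2 * b - 2 * a\<^sup>2"
  have "0 \<le> a * S" using a S(1) by simp
  then have u_gt: "6 * a\<^sup>2 - 4 * a < u"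
    using P unfolding u_def D_def by (simp add: power2_eq_square algebra_simps)
  have aa2: "a \<le> a\<^sup>2" using aa by (simp add: power2_eq_square)
  have u: "u < a * x" using lo by (simp add: u_def P_def)
  have "0 < u" using u_gt aa2 a by linarith
  then have "0 < a * x" using u by simp
  then show x: "0 < x" using a by (simp add: zero_less_mult_iff)
  have up: "a * x + 2 * b \<le> 2 * P" using hi by (simp add: P_def)
  have "- (2 * P) \<le> a * x + 2 * b"
  proof -
    have "D = 4 * a\<^sup>2 - 2 * a + b" unfolding D_def by (simp add: power2_eq_square algebra_simps)
    then show ?thesis using u P \<open>0 \<le> a * S\<close> aa2 a b unfolding u_def by linarith
  qed
  with up have "(a * x + 2 * b)\<^sup>2 \<le> (2 * P)\<^sup>2"
    by (intro abs_le_square_iff[THEN iffD1]) (use \<open>0 \<le> P\<close> in linarith)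
  then have "a * (a * x\<^sup>2 + 4 * b * x) \<le> a * (4 * n)"
    using P2 by (simp add: power2_eq_square algebra_simps)
  then show "a * x\<^sup>2 + 4 * b * x \<le> 4 * n" using a by simp
  have "(a * S)\<^sup>2 < (P - D)\<^sup>2"
    using P \<open>0 \<le> a * S\<close> by (intro power_strict_mono) auto
  moreover have "u\<^sup>2 + (2 * a + 3 * b) * u + 4 * a\<^sup>2 - 3 * (a * n) = (P - D)\<^sup>2 - a\<^sup>2 * (6 * E)"
  proof -
    have an: "a * n = P\<^sup>2 - b\<^sup>2" using P2 by simp
    show ?thesis unfolding an u_def D_def E_def by (simp add: power2_eq_square algebra_simps)
  qed
  ultimately have f_u: "0 < u\<^sup>2 + (2 * a + 3 * b) * u + 4 * a\<^sup>2 - 3 * (a * n)"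
    using S(2) by (simp add: power_mult_distrib)
  \<comment> \<open>The quadratic that is positive at u increases from u to a x; this product is the
    increment.\<close>
  have "0 < (a * x - u) * (a * x + u + (2 * a + 3 * b))"
    using u u_gt aa2 a b by (intro mult_pos_pos) linarith+
  then have "0 < (a * x)\<^sup>2 + (2 * a + 3 * b) * (a * x) + 4 * a\<^sup>2 - 3 * (a * n)"
    using f_u by (simp add: power2_eq_square algebra_simps)
  then have "a * (3 * n) < a * (a * x\<^sup>2 + (2 * a + 3 * b) * x + 4 * a)"
    by (simp add: power2_eq_square algebra_simps)
  then show "3 * n < a * x\<^sup>2 + (2 * a + 3 * b) * x + 4 * a" using a by simp
qed

theorem theorem3:
  fixes a b n :: int
  assumes "a > 0"
    and "b > - a"
    and "even b"
    and "gcd a b = 1"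
    and "\<not> [n = 0] (mod 4)"
    and "real_of_int n >
      4 * real_of_int a * (7 * real_of_int a * (real_of_int a - 1) + 1)
      + 2 * (7 * real_of_int a - 2) * real_of_int b
      + 2 * (2 * real_of_int a * (2 * real_of_int a - 1) + real_of_int b)
          * sqrt (6 * (2 * real_of_int a * (real_of_int a - 1) + real_of_int b))"
  shows "\<exists>w x y z :: nat.
    n = int w * (a * int w + b) + int x * (a * int x + b)
      + int y * (a * int y + b) + int z * (a * int z + b)"
proof -
  have "odd a"
  proof
    assume "even a"
    then have "2 dvd gcd a b" using assms(3) by simp
    then show False using assms(4) by simp
  qed
  then have cop2: "coprime a 2" by simp
  have "coprime b a" using assms(4) by (simp add: coprime_iff_gcd_eq_1 gcd.commute)
  then obtain i where i: "[b * i = 1] (mod a)" using cong_solve_coprime_int by blast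
  \<comment> \<open>The class of B modulo 2 a: b B = n mod a makes A = (n - b B) / a an integer, and
    B = n mod 2 provides the parity. The moduli are coprime as a is odd.\<close>
  obtain r where r: "[r = i * n] (mod a)" "[r = n] (mod 2)"
    using binary_chinese_remainder_int[OF cop2] by blast
  \<comment> \<open>The positive root of a x^2 + 4 b x = 4 n; B is then the largest element of its
    class not exceeding U.\<close>
  define U where "U = (2 * sqrt (real_of_int a * real_of_int n + (real_of_int b)\<^sup>2) - 2 * real_of_int b) / real_of_int a"
  define k where "k = \<lfloor>(U - real_of_int r) / (2 * real_of_int a)\<rfloor>"
  define B where "B = r + 2 * a * k"
  have apos: "0 < real_of_int a" using assms(1) by simp
  have "real_of_int k \<le> (U - real_of_int r) / (2 * real_of_int a)"
    "(U - real_of_int r) / (2 * real_of_int a) < real_of_int k + 1"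
    unfolding k_def by linarith+
  then have BU: "real_of_int B \<le> U" "U < real_of_int B + 2 * real_of_int a"
    using apos by (simp_all add: B_def field_simps)
  have aU: "real_of_int a * U = 2 * sqrt (real_of_int a * real_of_int n + (real_of_int b)\<^sup>2) - 2 * real_of_int b"
    using apos by (simp add: U_def)
  have hi: "real_of_int a * real_of_int B \<le> real_of_int a * U"
    using BU(1) apos by simp
  have "real_of_int a * U < real_of_int a * (real_of_int B + 2 * real_of_int a)"
    using BU(2) apos by simp
  then have lo: "real_of_int a * U - 2 * (real_of_int a)\<^sup>2 < real_of_int a * real_of_int B"
    by (simp add: power2_eq_square algebra_simps)
  have "0 \<le> 2 * a * (a - 1) + b"
  proof (cases "a = 1")
    case False
    then have "a * 1 \<le> a * (a - 1)" using assms(1) by (intro mult_left_mono) auto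
    then show ?thesis using assms(1,2) by (simp only: mult.assoc mult_1_right)
  qed (use assms(2) in simp)
  then have E: "0 \<le> 2 * real_of_int a * (real_of_int a - 1) + real_of_int b"
    by (metis (no_types) of_int_0_le_iff of_int_1 of_int_add of_int_diff of_int_mult of_int_numeral)
  note window = admissible_window[of "real_of_int a" "real_of_int b" "real_of_int n" "real_of_int B",
      OF _ _ E assms(6) lo[unfolded aU] hi[unfolded aU]]
  have a1: "1 \<le> real_of_int a" and ba: "- real_of_int a < real_of_int b"
    using assms(1,2) by linarith+
  have B0: "0 < B" using window(1)[OF a1 ba] by simp
  have upper: "a * B\<^sup>2 + 4 * b * B \<le> 4 * n"
  proof -
    have "real_of_int (a * B\<^sup>2 + 4 * b * B) \<le> real_of_int (4 * n)"
      using window(2)[OF a1 ba] by simp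
    then show ?thesis by (simp only: of_int_le_iff)
  qed
  have lower: "3 * n < a * B\<^sup>2 + (2 * a + 3 * b) * B + 4 * a"
  proof -
    have "real_of_int (3 * n) < real_of_int (a * B\<^sup>2 + (2 * a + 3 * b) * B + 4 * a)"
      using window(3)[OF a1 ba] by simp
    then show ?thesis by (simp only: of_int_less_iff)
  qed
  have Br: "[B = r] (mod a)" "[B = r] (mod 2)"
    by (simp_all add: B_def cong_iff_dvd_diff)
  have "[b * B = b * (i * n)] (mod a)"
    by (rule cong_mult[OF cong_refl cong_trans[OF Br(1) r(1)]])
  also have "b * (i * n) = (b * i) * n" by simp
  also have "[(b * i) * n = 1 * n] (mod a)" by (rule cong_mult[OF i cong_refl])
  finally have "[n = b * B] (mod a)" by (simp add: cong_sym)
  then obtain A where A: "n - b * B = a * A" by (auto simp: cong_iff_dvd_diff)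
  then have nAB: "n = a * A + b * B" by simp
  have Bn: "odd B \<longleftrightarrow> odd n"
    using cong_trans[OF Br(2) r(2)] by (simp add: cong_def) presburger
  \<comment> \<open>For odd n, a odd and b even make A odd. For even n both b and B are even, so a A
    = n mod 4; since 4 does not divide n, A is 2 mod 4.\<close>
  have par: "odd A \<and> odd B \<or> A mod 4 = 2 \<and> even B"
  proof (cases "odd n")
    case True
    then show ?thesis using nAB assms(3) Bn by auto
  next
    case False
    then have "even A" "even B" using nAB assms(3) Bn \<open>odd a\<close> by auto
    have "4 dvd b * B" using mult_dvd_mono[OF assms(3) \<open>even B\<close>] by simp
    have "\<not> 4 dvd A"
    proof
      assume "4 dvd A"
      then have "4 dvd n" using nAB \<open>4 dvd b * B\<close> by simp
      then show False using assms(5) by (simp add: cong_0_iff)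
    qed
    with \<open>even A\<close> have "A mod 4 = 2" by presburger
    then show ?thesis using \<open>even B\<close> by simp
  qed
  \<comment> \<open>Substituting n = a A + b B cancels the terms in b, and dividing by a leaves the
    size conditions of Cauchy's lemma.\<close>
  have "a * B\<^sup>2 \<le> a * (4 * A)" using upper unfolding nAB by (simp add: algebra_simps)
  then have "B\<^sup>2 \<le> 4 * A" using assms(1) by simp
  moreover have "a * (3 * A) < a * (B\<^sup>2 + 2 * B + 4)"
    using lower unfolding nAB by (simp add: algebra_simps)
  then have "3 * A < B\<^sup>2 + 2 * B + 4" using assms(1) by simp
  ultimately obtain w x y z :: nat where
    "A = (int w)\<^sup>2 + (int x)\<^sup>2 + (int y)\<^sup>2 + (int z)\<^sup>2" "B = int w + int x + int y + int z"
    using cauchy_lemma[OF par] B0 by (meson less_imp_le)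
  then have "n = int w * (a * int w + b) + int x * (a * int x + b)
      + int y * (a * int y + b) + int z * (a * int z + b)"
    unfolding nAB by (simp add: power2_eq_square algebra_simps)
  then show ?thesis by blast
qed

end
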